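(* Let $q\ge9$ be a power of $3$. The EA-lines form three $G_q$-orbits, of sizes $q^3-q$, $\frac12(q^2-1)$, $\frac12(q^2-1)$; let $\mathcal O_1$ be the orbit of size $q^3-q$, and label the two orbits of size $\frac12(q^2-1)$ as $\mathcal O_2,\mathcal O_3$ suitably. Writing $\Pi_{\pi,j}$ for the number of $\pi$-planes through any line of $\mathcal O_j$ and $\Lambda_{j,\pi}$ for the number of lines of $\mathcal O_j$ in a $\pi$-plane, we have: $\Pi_{2_{\mathcal C},1}=\Lambda_{2,3_{\mathcal C}}=\Lambda_{2,0_{\mathcal C}}=\Lambda_{3,\overline{1_{\mathcal C}}}=1$; $\Lambda_{1,2_{\mathcal C}}=\Lambda_{1,\overline{1_{\mathcal C}}}=q-1$; $\Pi_{\pi,2}=\Lambda_{2,\pi}=0$ for $\pi\in\{2_{\mathcal C},\overline{1_{\mathcal C}}\}$, and $\Pi_{\pi,3}=\Lambda_{3,\pi}=0$ for $\pi\in\{2_{\mathcal C},3_{\mathcal C},0_{\mathcal C}\}$; $\Pi_{\overline{1_{\mathcal C}},3}=\Lambda_{1,0_{\mathcal C}}=q$; $\Pi_{3_{\mathcal C},2}=\Pi_{0_{\mathcal C},1}=\frac13q$; $\Pi_{0_{\mathcal C},2}=\frac23q$; $\Pi_{3_{\mathcal C},1}=\frac16(q-3)$, $\Lambda_{1,3_{\mathcal C}}=q-3$; $\Pi_{\overline{1_{\mathcal C}},1}=\frac12(q-1)$.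
   Context: Let $\mathrm{PG}(3,q)$ have points $\mathbf{P}(x_0,x_1,x_2,x_3)$; put $P(t)=\mathbf{P}(t^3,t^2,t,1)$ ($t\in\mathbb{F}_q$), $P(\infty)=\mathbf{P}(1,0,0,0)$, $\mathcal{C}=\{P(t):t\in\mathbb{F}_q\cup\{\infty\}\}$ the twisted cubic, $G_q$ the group of projectivities fixing $\mathcal C$. Write $\boldsymbol{\pi}(c_0,c_1,c_2,c_3)$ for the plane $c_0x_0+c_1x_1+c_2x_2+c_3x_3=0$. $\Gamma$-planes: osculating planes $\boldsymbol{\pi}(1,-3t,3t^2,-t^3)$ ($t\in\mathbb{F}_q$) and $\boldsymbol{\pi}(0,0,0,1)$; for $q\equiv0\pmod3$ they all contain a common line, the axis $\mathrm{A}$. A $d_{\mathcal C}$-plane ($d\in\{0,2,3\}$) contains exactly $d$ points of $\mathcal C$; a $\overline{1_{\mathcal C}}$-plane is a non-$\Gamma$-plane with exactly one point of $\mathcal C$ (each plane type is a $G_q$-orbit for $q\ge5$). An EA-line is a line containing no point of $\mathcal C$, different from $\mathrm{A}$, meeting $\mathrm{A}$. Known fact: for $q\equiv0\pmod 3$, $q\ge9$, the EA-lines form exactly three $G_q$-orbits, of sizes $q^3-q$, $\frac12(q^2-1)$, $\frac12(q^2-1)$, namely the orbits of the lines through $\mathbf{P}(0,1,0,0)$ and respectively $\mathbf{P}(0,0,1,1)$, $\mathbf{P}(1,0,1,0)$, $\mathbf{P}(1,0,\rho,0)$, with $\rho$ a non-square in $\mathbb{F}_q$. *)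

theory Defs
  imports "HOL-Analysis.Analysis" "HOL-Library.FuncSet"
begin

text \<open>
  Points, lines and planes of PG(3,q) are the linear subspaces of dimension 1, 2, 3 of
  \<^typ>\<open>'a^4\<close>, where \<^typ>\<open>'a\<close> is a field with q elements; incidence is inclusion. The
  homogeneous coordinates written \<open>x\<^sub>0, x\<^sub>1, x\<^sub>2, x\<^sub>3\<close> in the literature are the components
  \<open>x $ 1, x $ 2, x $ 3, x $ 4\<close>, in this order.
\<close>

definition pg_points :: "('a::field ^ 4) set set" where
  "pg_points = {S. vec.subspace S \<and> vec.dim S = 1}"

definition pg_lines :: "('a::field ^ 4) set set" where
  "pg_lines = {S. vec.subspace S \<and> vec.dim S = 2}"

definition pg_planes :: "('a::field ^ 4) set set" where
  "pg_planes = {S. vec.subspace S \<and> vec.dim S = 3}"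

definition point :: "'a::field \<Rightarrow> 'a \<Rightarrow> 'a \<Rightarrow> 'a \<Rightarrow> ('a ^ 4) set" where
  "point x0 x1 x2 x3 = vec.span {vector [x0, x1, x2, x3]}"

definition plane :: "'a::field \<Rightarrow> 'a \<Rightarrow> 'a \<Rightarrow> 'a \<Rightarrow> ('a ^ 4) set" where
  "plane c0 c1 c2 c3 = {x. c0 * x $ 1 + c1 * x $ 2 + c2 * x $ 3 + c3 * x $ 4 = 0}"

definition twisted_cubic :: "('a::field ^ 4) set set" where
  "twisted_cubic = insert (point 1 0 0 0) (range (\<lambda>t. point (t^3) (t^2) t 1))"

text \<open>
  Restricting the induced maps to subspaces makes proportional matrices give the same
  projectivity, so this set is PGL(4,q).
\<close>

definition projectivities :: "(('a::field ^ 4) set \<Rightarrow> ('a ^ 4) set) set" where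
  "projectivities =
     {restrict (\<lambda>S. (\<lambda>v. A *v v) ` S) {S. vec.subspace S} | A :: 'a ^ 4 ^ 4. invertible A}"

definition cubic_group :: "(('a::field ^ 4) set \<Rightarrow> ('a ^ 4) set) set" where
  "cubic_group = {g \<in> projectivities. g ` twisted_cubic = twisted_cubic}"

definition Gamma_planes :: "('a::field ^ 4) set set" where
  "Gamma_planes =
     insert (plane 0 0 0 1) (range (\<lambda>t. plane 1 (- 3 * t) (3 * t^2) (- (t^3))))"

definition cubic_points_on :: "('a::field ^ 4) set \<Rightarrow> ('a ^ 4) set set" where
  "cubic_points_on S = {p \<in> twisted_cubic. p \<subseteq> S}"

definition dC_planes :: "nat \<Rightarrow> ('a::field ^ 4) set set" where
  "dC_planes d = {S \<in> pg_planes. card (cubic_points_on S) = d}"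

definition one_bar_planes :: "('a::field ^ 4) set set" where
  "one_bar_planes = dC_planes 1 - Gamma_planes"

text \<open>This intersection is a line exactly in characteristic 3.\<close>

definition axis :: "('a::field ^ 4) set" where
  "axis = \<Inter> Gamma_planes"

definition EA_lines :: "('a::field ^ 4) set set" where
  "EA_lines = {L \<in> pg_lines. cubic_points_on L = {} \<and> L \<noteq> axis \<and>
                 (\<exists>p \<in> pg_points. p \<subseteq> L \<and> p \<subseteq> axis)}"

definition cubic_orbit :: "('a::field ^ 4) set \<Rightarrow> ('a ^ 4) set set" where
  "cubic_orbit L = (\<lambda>g. g L) ` cubic_group"

definition EA_orbits :: "('a::field ^ 4) set set set" where
  "EA_orbits = cubic_orbit ` EA_lines"

text \<open>
  The incidence numbers \<open>\<Pi>\<^sub>\<pi>\<^sub>,\<^sub>j\<close> and \<open>\<Lambda>\<^sub>j\<^sub>,\<^sub>\<pi>\<close>: the common value \<open>n\<close> of the number of planes of a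
  class \<open>\<P>\<close> through a line of a class \<open>\<O>\<close>, and of the number of lines of \<open>\<O>\<close> in a plane of \<open>\<P>\<close>.
  The value is rational because closed forms such as \<open>(q - 3) / 6\<close> involve division.
\<close>

definition Pi_number ::
  "('a::field ^ 4) set set \<Rightarrow> ('a ^ 4) set set \<Rightarrow> rat \<Rightarrow> bool" where
  "Pi_number \<P> \<O> n \<longleftrightarrow> (\<forall>L \<in> \<O>. of_nat (card {S \<in> \<P>. L \<subseteq> S}) = n)"

definition Lambda_number ::
  "('a::field ^ 4) set set \<Rightarrow> ('a ^ 4) set set \<Rightarrow> rat \<Rightarrow> bool" where
  "Lambda_number \<O> \<P> n \<longleftrightarrow> (\<forall>S \<in> \<P>. of_nat (card {L \<in> \<O>. L \<subseteq> S}) = n)"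

end

theory Submission
  imports Defs "HOL-Computational_Algebra.Polynomial"
begin

text \<open>
  In characteristic 3 the axis is the line \<open>x\<^sub>0 = x\<^sub>3 = 0\<close>. A matrix \<open>A\<close> preserving the cubic has row
  polynomials \<open>f\<^sub>0, \<dots>, f\<^sub>3\<close> (the coordinates of \<open>A P(t)\<close>) with \<open>f\<^sub>0 f\<^sub>2 = f\<^sub>1\<^sup>2\<close> and \<open>f\<^sub>0 f\<^sub>3 = f\<^sub>1 f\<^sub>2\<close>,
  first pointwise and then, as the degrees are at most 6 < q, as polynomials. So \<open>f\<^sub>0\<^sup>2 f\<^sub>3\<close> is a cube
  and has derivative 0: the Wronskian of \<open>f\<^sub>0\<close> and \<open>f\<^sub>3\<close> vanishes, both are combinations of \<open>t\<^sup>3\<close> and 1,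
  and \<open>A\<close> preserves the axis.

  The maps \<open>t \<mapsto> t + b\<close>, \<open>t \<mapsto> a t\<close>, \<open>t \<mapsto> 1 / t\<close> act transitively on the points of the axis, so all
  incidences can be counted at \<open>P(0,1,0,0)\<close>. A plane through this point that does not contain the axis
  has the form \<open>x\<^sub>2 = \<alpha> x\<^sub>0 + \<beta> x\<^sub>3\<close>; its affine cubic points are the roots of the additive equation
  \<open>t = \<alpha> t\<^sup>3 + \<beta>\<close>, so it has 2 cubic points if \<open>\<alpha> = 0\<close>, one if \<open>\<alpha>\<close> is a non-square, and 0 or 3
  otherwise. The EA-lines through the point are \<open>(x\<^sub>0 : x\<^sub>2 : x\<^sub>3) = (u : v : 1)\<close> with \<open>u \<noteq> v\<^sup>3\<close>, which lie
  in a plane of the first kind, and \<open>(1 : v : 0)\<close> with \<open>v \<noteq> 0\<close>, which lie in the planes with \<open>\<alpha> = v\<close>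
  only. Hence the types of the planes on a line separate three classes, and each class is one orbit.
\<close>

section \<open>Linear algebra of lines and planes in four coordinates\<close>

lemma vec4_eq_iff:
  "x = y \<longleftrightarrow> x $ 1 = y $ 1 \<and> x $ 2 = y $ 2 \<and> x $ 3 = y $ 3 \<and> x $ 4 = y $ 4" for x y :: "'b ^ 4"
  by (simp add: vec_eq_iff forall_4)

lemma vector_4 [simp]:
  fixes w x y z :: "'b::zero"
  shows "(vector [w, x, y, z] :: 'b ^ 4) $ 1 = w" "(vector [w, x, y, z] :: 'b ^ 4) $ 2 = x"
    "(vector [w, x, y, z] :: 'b ^ 4) $ 3 = y" "(vector [w, x, y, z] :: 'b ^ 4) $ 4 = z"
  unfolding vector_def by simp_all

lemma dim_span_pair:
  fixes x y :: "'a::field ^ 4"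
  assumes "y \<noteq> 0" "x \<notin> vec.span {y}"
  shows "vec.dim (vec.span {x, y}) = 2"
  using assms by (simp add: vec.dim_insert)

lemma subspace_eq_of_dim_le:
  fixes S T :: "('a::field ^ 4) set"
  assumes "vec.subspace S" "vec.subspace T" "S \<subseteq> T" "vec.dim T \<le> vec.dim S"
  shows "S = T"
  using assms vec.subspace_dim_equal by metis

lemma subspace_plane: "vec.subspace (plane a b c d)"
  unfolding plane_def vec.subspace_def
proof (intro conjI ballI allI, goal_cases)
  case (2 x y)
  have "a * (x $ 1 + y $ 1) + b * (x $ 2 + y $ 2) + c * (x $ 3 + y $ 3) + d * (x $ 4 + y $ 4)
    = (a * x $ 1 + b * x $ 2 + c * x $ 3 + d * x $ 4) + (a * y $ 1 + b * y $ 2 + c * y $ 3 + d * y $ 4)"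
    by (simp add: algebra_simps)
  then show ?case using 2 by simp
next
  case (3 r x)
  have "a * (r * x $ 1) + b * (r * x $ 2) + c * (r * x $ 3) + d * (r * x $ 4)
    = r * (a * x $ 1 + b * x $ 2 + c * x $ 3 + d * x $ 4)"
    by (simp add: algebra_simps)
  then show ?case using 3 by simp
qed simp

text \<open>A nonzero linear form does not vanish at some unit vector \<open>w\<close>. Subtracting
  a multiple of \<open>w\<close> moves any vector into the kernel, so the kernel and
  \<open>w\<close> together span the space.\<close>

lemma plane_in_pg_planes:
  fixes a b c d :: "'a::field"
  assumes "a \<noteq> 0 \<or> b \<noteq> 0 \<or> c \<noteq> 0 \<or> d \<noteq> 0"
  shows "plane a b c d \<in> pg_planes"
proof -
  define f where "f x = a * x $ 1 + b * x $ 2 + c * x $ 3 + d * x $ 4" for x :: "'a ^ 4"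
  have f_diff: "f (x - k *s y) = f x - k * f y" for x y k
    by (simp add: f_def algebra_simps)
  have mem: "x \<in> plane a b c d \<longleftrightarrow> f x = 0" for x
    by (simp add: plane_def f_def)
  have "f (vector [1,0,0,0]) = a" "f (vector [0,1,0,0]) = b" "f (vector [0,0,1,0]) = c"
    "f (vector [0,0,0,1]) = d"
    by (simp_all add: f_def)
  then obtain w where w: "f w \<noteq> 0" using assms by metis
  have "vec.span (insert w (plane a b c d)) = UNIV"
  proof -
    have "x \<in> vec.span (insert w (plane a b c d))" for x
    proof (rule vec.span_breakdown_eq[THEN iffD2], intro exI)
      show "x - (f x / f w) *s w \<in> vec.span (plane a b c d)"
        by (rule vec.span_base) (simp add: mem f_diff w)
    qed
    then show ?thesis by blast
  qed
  then have "vec.dim (insert w (plane a b c d)) = 4"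
    using vec.dim_span[of "insert w (plane a b c d)"] vec_dim_card[where 'a = 'a and 'n = 4]
    by (simp del: vec.dim_span vec.dim_UNIV)
  moreover have "w \<notin> vec.span (plane a b c d)"
    using w mem vec.span_eq_iff[THEN iffD2, OF subspace_plane[of a b c d]] by metis
  ultimately have "vec.dim (plane a b c d) = 3"
    by (simp add: vec.dim_insert)
  then show ?thesis by (simp add: pg_planes_def subspace_plane)
qed

text \<open>The coefficients form a kernel vector: a matrix whose rows are a basis of
  \<open>S\<close> and a zero row is not surjective, hence not injective.\<close>

lemma pg_planeE:
  fixes S :: "('a::field ^ 4) set"
  assumes "S \<in> pg_planes"
  obtains a b c d where "S = plane a b c d" "a \<noteq> 0 \<or> b \<noteq> 0 \<or> c \<noteq> 0 \<or> d \<noteq> 0"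
proof -
  have S: "vec.subspace S" "vec.dim S = 3" using assms by (auto simp: pg_planes_def)
  obtain B where B: "B \<subseteq> S" "vec.independent B" "S \<subseteq> vec.span B" "card B = 3"
    using vec.basis_exists[of S] S by metis
  then obtain x y z where B3: "B = {x, y, z}" by (auto simp: card_3_iff)
  define A :: "'a ^ 4 ^ 4" where "A = vector [x, y, z, 0]"
  have row: "(A *v v) $ 1 = (\<Sum>j\<in>UNIV. x $ j * v $ j)" "(A *v v) $ 2 = (\<Sum>j\<in>UNIV. y $ j * v $ j)"
     "(A *v v) $ 3 = (\<Sum>j\<in>UNIV. z $ j * v $ j)" "(A *v v) $ 4 = 0" for v
    by (simp_all add: matrix_vector_mult_def A_def)
  have "\<not> (\<exists>C. A ** C = mat 1)"
  proof
    assume "\<exists>C. A ** C = mat 1"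
    then have "surj ((*v) A)" using matrix_right_invertible_surjective by blast
    then obtain v where "A *v v = vector [0,0,0,1]" by (metis surjD)
    then have "(A *v v) $ 4 = 1" by simp
    then show False using row(4) by simp
  qed
  then have "\<not> (\<exists>C. C ** A = mat 1)" using matrix_left_right_inverse by metis
  then obtain v where v: "A *v v = 0" "v \<noteq> 0"
    using matrix_left_invertible_ker by metis
  have "B \<subseteq> plane (v $ 1) (v $ 2) (v $ 3) (v $ 4)"
    using v row[of v] by (auto simp: B3 plane_def sum_4 mult.commute)
  then have "vec.span B \<subseteq> plane (v $ 1) (v $ 2) (v $ 3) (v $ 4)"
    by (meson subspace_plane vec.span_minimal)
  then have sub: "S \<subseteq> plane (v $ 1) (v $ 2) (v $ 3) (v $ 4)" using B by blast
  have nz: "v $ 1 \<noteq> 0 \<or> v $ 2 \<noteq> 0 \<or> v $ 3 \<noteq> 0 \<or> v $ 4 \<noteq> 0"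
    using v(2) by (auto simp: vec4_eq_iff)
  have "S = plane (v $ 1) (v $ 2) (v $ 3) (v $ 4)"
    by (rule subspace_eq_of_dim_le[OF S(1) subspace_plane sub])
      (use plane_in_pg_planes[OF nz] S in \<open>simp add: pg_planes_def\<close>)
  then show thesis using nz that by blast
qed

subsection \<open>Invertible matrices acting on subspaces\<close>

text \<open>The action before restriction to subspaces, so that products of matrices compose without
  the side conditions that \<open>restrict\<close> brings.\<close>

definition act :: "'a::field ^ 4 ^ 4 \<Rightarrow> ('a ^ 4) set \<Rightarrow> ('a ^ 4) set" where
  "act A S = (\<lambda>v. A *v v) ` S"

text \<open>The preimage of \<open>cubic_group\<close> in GL(4,q). Proportional matrices are
  distinct elements here but act alike on subspaces, so the orbits are the same.\<close>

definition cubic_matrices :: "('a::field ^ 4 ^ 4) set" where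
  "cubic_matrices = {A. invertible A \<and> act A ` twisted_cubic = twisted_cubic}"

lemma act_act: "act A (act B S) = act (A ** B) S"
  by (simp add: act_def image_image matrix_vector_mul_assoc)

lemma act_one [simp]: "act (mat 1) S = S"
  by (simp add: act_def)

lemma act_mono: "S \<subseteq> T \<Longrightarrow> act A S \<subseteq> act A T"
  by (auto simp: act_def)

lemma subspace_act: "vec.subspace S \<Longrightarrow> vec.subspace (act A S)"
  unfolding act_def by (rule vec.subspace_image)

lemma inj_matrix: "invertible A \<Longrightarrow> inj ((*v) A)" for A :: "'a::field ^ 4 ^ 4"
  by (simp add: inj_matrix_vector_mult)

lemma act_eq_iff: "invertible A \<Longrightarrow> act A S = act A T \<longleftrightarrow> S = T"
  unfolding act_def by (rule inj_image_eq_iff[OF inj_matrix])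

lemma act_subset_iff: "invertible A \<Longrightarrow> act A S \<subseteq> act A T \<longleftrightarrow> S \<subseteq> T"
  unfolding act_def by (rule inj_image_subset_iff[OF inj_matrix])

lemma act_mem_iff: "invertible A \<Longrightarrow> A *v v \<in> act A S \<longleftrightarrow> v \<in> S"
  unfolding act_def by (rule inj_image_mem_iff[OF inj_matrix])

lemma dim_act: "invertible A \<Longrightarrow> vec.dim (act A S) = vec.dim S"
  unfolding act_def
  by (rule vec.dim_image_eq)
    (auto intro: inj_on_subset[OF inj_matrix])

lemma act_span_single: "act A (vec.span {v}) = vec.span {A *v v}"
  unfolding act_def by (simp add: vec.span_image[symmetric])

lemma cubic_matricesD: "A \<in> cubic_matrices \<Longrightarrow> invertible A"
  by (simp add: cubic_matrices_def)

lemma cubic_matrices_mult: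
  "A \<in> cubic_matrices \<Longrightarrow> B \<in> cubic_matrices \<Longrightarrow> A ** B \<in> cubic_matrices"
  by (auto simp: cubic_matrices_def invertible_mult act_act[symmetric] image_image[symmetric])

lemma cubic_matrices_inverse:
  assumes "A \<in> cubic_matrices"
  obtains B where "B \<in> cubic_matrices" "A ** B = mat 1" "B ** A = mat 1"
proof -
  obtain B where B: "A ** B = mat 1" "B ** A = mat 1"
    using assms by (auto simp: cubic_matrices_def invertible_def)
  have "act B ` twisted_cubic = act B ` (act A ` twisted_cubic)"
    using assms by (simp add: cubic_matrices_def)
  also have "\<dots> = twisted_cubic" by (simp add: image_image act_act B)
  finally have "B \<in> cubic_matrices" using B by (auto simp: cubic_matrices_def invertible_def)
  then show thesis using B that by blast
qed

text \<open>On subspaces \<open>restrict\<close> changes nothing, and both \<open>L\<close> and the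
  points of the cubic are subspaces. From here on the orbits are computed with matrices
  alone.\<close>

lemma cubic_orbit_eq:
  fixes L :: "('a::field ^ 4) set"
  assumes "vec.subspace L"
  shows "cubic_orbit L = (\<lambda>A. act A L) ` cubic_matrices"
proof -
  have tc: "p \<in> twisted_cubic \<Longrightarrow> vec.subspace p" for p :: "('a::field ^ 4) set"
    by (auto simp: twisted_cubic_def point_def)
  have eq: "restrict (act A) {S. vec.subspace S} ` twisted_cubic = act A ` twisted_cubic" for A :: "'a ^ 4 ^ 4"
    by (rule image_cong) (auto simp: tc)
  have "(cubic_group :: (('a ^ 4) set \<Rightarrow> ('a ^ 4) set) set) = (\<lambda>A. restrict (act A) {S. vec.subspace S}) ` cubic_matrices"
  proof (intro set_eqI iffI)
    fix g :: "('a ^ 4) set \<Rightarrow> ('a ^ 4) set"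
    assume "g \<in> cubic_group"
    then obtain A :: "'a ^ 4 ^ 4" where A: "invertible A" "g = restrict (act A) {S. vec.subspace S}"
      "g ` twisted_cubic = twisted_cubic"
      by (auto simp: cubic_group_def projectivities_def act_def[abs_def])
    then have "act A ` twisted_cubic = twisted_cubic" using eq[of A] by simp
    then show "g \<in> (\<lambda>A. restrict (act A) {S. vec.subspace S}) ` cubic_matrices"
      using A by (auto simp: cubic_matrices_def)
  next
    fix g :: "('a ^ 4) set \<Rightarrow> ('a ^ 4) set"
    assume "g \<in> (\<lambda>A. restrict (act A) {S. vec.subspace S}) ` cubic_matrices"
    then obtain A :: "'a ^ 4 ^ 4" where A: "invertible A" "g = restrict (act A) {S. vec.subspace S}"
      "act A ` twisted_cubic = twisted_cubic"
      by (auto simp: cubic_matrices_def)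
    then have "g ` twisted_cubic = twisted_cubic" using eq[of A] by simp
    then show "g \<in> cubic_group"
      using A by (auto simp: cubic_group_def projectivities_def act_def[abs_def])
  qed
  note group = this
  show ?thesis unfolding cubic_orbit_def group image_image using assms by simp
qed

text \<open>\<open>act A\<close> is a bijection with inverse \<open>act B\<close> for the inverse
  matrix \<open>B\<close>. Both have to map \<open>K\<close> into itself, which is why the
  assumption on \<open>K\<close> ranges over all of \<open>cubic_matrices\<close>.\<close>

lemma card_transport:
  fixes K :: "('a::{field,finite} ^ 4) set set"
  assumes A: "A \<in> cubic_matrices"
    and K: "\<And>A S. A \<in> cubic_matrices \<Longrightarrow> S \<in> K \<Longrightarrow> act A S \<in> K"
    and P: "\<And>S. P S \<longleftrightarrow> P' (act A S)"
  shows "card {S \<in> K. P S} = card {S \<in> K. P' S}"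
proof -
  obtain B where B: "B \<in> cubic_matrices" "A ** B = mat 1" "B ** A = mat 1"
    using cubic_matrices_inverse[OF A] .
  have "bij_betw (act A) {S \<in> K. P S} {S \<in> K. P' S}"
    by (rule bij_betw_byWitness[where f' = "act B"]) (auto simp: act_act B P K A)
  then show ?thesis by (rule bij_betw_same_card)
qed

section \<open>The twisted cubic as an intersection of quadrics\<close>

lemma span_single_subset_iff: "vec.subspace S \<Longrightarrow> vec.span {v} \<subseteq> S \<longleftrightarrow> v \<in> S"
  for S :: "('a::field ^ 4) set"
  by (meson insert_subset empty_subsetI vec.span_minimal vec.span_base insertI1 subsetD)

definition cubic_vec :: "'a::field \<Rightarrow> 'a ^ 4" where
  "cubic_vec t = vector [t ^ 3, t ^ 2, t, 1]"

text \<open>The vanishing of the 2x2 minors of the matrix with rows (x0, x1, x2) and (x1, x2, x3).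
  These equations are homogeneous, so they can be tested on any vector that spans a point.\<close>

definition on_cubic_cone :: "'a::field ^ 4 \<Rightarrow> bool" where
  "on_cubic_cone v \<longleftrightarrow> v $ 1 * v $ 3 = v $ 2 ^ 2 \<and> v $ 2 * v $ 4 = v $ 3 ^ 2 \<and> v $ 1 * v $ 4 = v $ 2 * v $ 3"

lemma cubic_vec_nth [simp]:
  "cubic_vec t $ 1 = t ^ 3" "cubic_vec t $ 2 = t ^ 2" "cubic_vec t $ 3 = t" "cubic_vec t $ 4 = 1"
  by (simp_all add: cubic_vec_def)

lemma twisted_cubic_eq:
  "twisted_cubic = insert (vec.span {vector [1, 0, 0, 0]}) (range (\<lambda>t. vec.span {cubic_vec t}))"
  by (simp add: twisted_cubic_def point_def cubic_vec_def)

lemma span_scale_single: "k \<noteq> 0 \<Longrightarrow> vec.span {k *s v} = vec.span {v}"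
  for v :: "'a::field ^ 4"
proof -
  assume k: "k \<noteq> 0"
  have "k *s v \<in> vec.span {v}" by (simp add: vec.span_scale vec.span_base)
  moreover have "(1 / k) *s (k *s v) \<in> vec.span {k *s v}" by (intro vec.span_scale vec.span_base) simp
  then have "v \<in> vec.span {k *s v}" using k by simp
  ultimately show ?thesis by (intro equalityI) (simp_all add: span_single_subset_iff)
qed

text \<open>If the last coordinate vanishes, the quadrics force the two middle ones to vanish too,
  which leaves the point (1,0,0,0). Otherwise they express the first two coordinates by the last
  two, and \<open>v\<close> is a multiple of \<open>cubic_vec (v $ 3 / v $ 4)\<close>.\<close>

lemma span_in_twisted_cubic_iff:
  fixes v :: "'a::field ^ 4"
  shows "vec.span {v} \<in> twisted_cubic \<longleftrightarrow> v \<noteq> 0 \<and> on_cubic_cone v"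
proof
  assume "vec.span {v} \<in> twisted_cubic"
  then obtain w where w: "vec.span {v} = vec.span {w}" "w \<noteq> 0" "on_cubic_cone w"
    unfolding twisted_cubic_eq
    by (auto simp: on_cubic_cone_def vec4_eq_iff power2_eq_square power3_eq_cube)
  have "v \<in> vec.span {w}" "w \<in> vec.span {v}" using w(1) vec.span_base by blast+
  then obtain k l where "v = k *s w" "w = l *s v" unfolding vec.span_singleton by blast
  then show "v \<noteq> 0 \<and> on_cubic_cone v" using w
    by (auto simp: on_cubic_cone_def power2_eq_square)
next
  assume v: "v \<noteq> 0 \<and> on_cubic_cone v"
  show "vec.span {v} \<in> twisted_cubic"
  proof (cases "v $ 4 = 0")
    case True
    then have "v = v $ 1 *s vector [1, 0, 0, 0]" "v $ 1 \<noteq> 0"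
      using v by (auto simp: on_cubic_cone_def vec4_eq_iff)
    then have "vec.span {v} = vec.span {vector [1, 0, 0, 0]}"
      using span_scale_single by metis
    then show ?thesis by (simp add: twisted_cubic_eq)
  next
    case False
    have cone: "v $ 2 * v $ 4 = v $ 3 ^ 2" "v $ 1 * v $ 4 = v $ 2 * v $ 3"
      using v by (auto simp: on_cubic_cone_def)
    have "v $ 1 * v $ 4 * v $ 4 = v $ 3 * (v $ 2 * v $ 4)" by (simp add: cone(2))
    also have "\<dots> = v $ 3 ^ 3" by (simp add: cone(1) power2_eq_square power3_eq_cube)
    finally have "v $ 2 = v $ 3 ^ 2 / v $ 4" "v $ 1 = v $ 3 ^ 3 / v $ 4 ^ 2"
      using cone(1) False by (simp_all only: power2_eq_square nonzero_eq_divide_eq mult.assoc mult_eq_0_iff simp_thms)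
    then have "v = v $ 4 *s cubic_vec (v $ 3 / v $ 4)"
      using False by (simp add: vec4_eq_iff field_simps power2_eq_square power3_eq_cube)
    then have "vec.span {v} = vec.span {cubic_vec (v $ 3 / v $ 4)}"
      using span_scale_single False by metis
    then show ?thesis by (simp add: twisted_cubic_eq)
  qed
qed

lemma twisted_cubicE:
  assumes "p \<in> twisted_cubic"
  obtains v where "p = vec.span {v}" "v \<noteq> 0" "on_cubic_cone v"
proof -
  obtain v where "p = vec.span {v}" using assms by (auto simp: twisted_cubic_eq)
  then show thesis using assms that span_in_twisted_cubic_iff by blast
qed

lemma invertible_mult_eq_0_iff: "invertible A \<Longrightarrow> A *v v = 0 \<longleftrightarrow> v = 0"
  for A :: "'a::field ^ 4 ^ 4"
  using inj_matrix[of A] by (metis injD matrix_vector_mult_0_right)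

text \<open>An injective map of the finite cubic into itself is onto, so it is enough to preserve
  the quadrics in one direction.\<close>

lemma cubic_matricesI:
  fixes A :: "'a::{field,finite} ^ 4 ^ 4"
  assumes A: "invertible A" and cone: "\<And>v. on_cubic_cone v \<Longrightarrow> on_cubic_cone (A *v v)"
  shows "A \<in> cubic_matrices"
proof -
  have sub: "act A ` twisted_cubic \<subseteq> twisted_cubic"
  proof (rule image_subsetI)
    fix p :: "('a ^ 4) set"
    assume "p \<in> twisted_cubic"
    then obtain v where "p = vec.span {v}" "v \<noteq> 0" "on_cubic_cone v" by (rule twisted_cubicE)
    then show "act A p \<in> twisted_cubic"
      by (simp add: act_span_single span_in_twisted_cubic_iff invertible_mult_eq_0_iff A cone)
  qed
  have "card (act A ` twisted_cubic) = card (twisted_cubic :: ('a ^ 4) set set)"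
    by (intro card_image inj_onI) (simp add: act_eq_iff A)
  then have "act A ` twisted_cubic = twisted_cubic"
    by (intro card_subset_eq sub) simp_all
  then show ?thesis using A by (simp add: cubic_matrices_def)
qed

lemma cubic_matrices_cone:
  assumes A: "A \<in> cubic_matrices" and v: "on_cubic_cone v"
  shows "on_cubic_cone (A *v v)"
proof (cases "v = 0")
  case False
  then have "vec.span {v} \<in> twisted_cubic" using v by (simp add: span_in_twisted_cubic_iff)
  then have "act A (vec.span {v}) \<in> twisted_cubic" using A by (auto simp: cubic_matrices_def)
  then show ?thesis by (simp add: act_span_single span_in_twisted_cubic_iff)
qed (use v in simp)

lemma cubic_points_on_act:
  assumes A: "A \<in> cubic_matrices"
  shows "cubic_points_on (act A S) = act A ` cubic_points_on S"
proof -
  have inv: "invertible A" using A by (rule cubic_matricesD)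
  have "p \<in> act A ` cubic_points_on S" if p: "p \<in> cubic_points_on (act A S)" for p
  proof -
    have "p \<in> act A ` twisted_cubic" using p A by (simp add: cubic_points_on_def cubic_matrices_def)
    then show ?thesis using p by (auto simp: cubic_points_on_def act_subset_iff[OF inv])
  qed
  moreover have "act A p \<in> cubic_points_on (act A S)" if "p \<in> cubic_points_on S" for p
    using that A by (auto simp: cubic_points_on_def act_subset_iff[OF inv] cubic_matrices_def)
  ultimately show ?thesis by blast
qed

lemma card_cubic_points_on_act:
  assumes A: "A \<in> cubic_matrices"
  shows "card (cubic_points_on (act A S)) = card (cubic_points_on S)"
  unfolding cubic_points_on_act[OF A]
  by (rule card_image) (auto simp: inj_on_def act_eq_iff cubic_matricesD[OF A])

lemma cubic_vec_span_eq_iff [simp]: "vec.span {cubic_vec s} = vec.span {cubic_vec t} \<longleftrightarrow> s = t"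
proof
  assume "vec.span {cubic_vec s} = vec.span {cubic_vec t}"
  then have "cubic_vec s \<in> vec.span {cubic_vec t}" using vec.span_base by blast
  then show "s = t" by (auto simp: vec.span_singleton vec4_eq_iff)
qed simp

lemma cubic_vec_span_neq: "vec.span {cubic_vec s} \<noteq> vec.span {vector [1, 0, 0, 0]}"
proof
  assume "vec.span {cubic_vec s} = vec.span {vector [1, 0, 0, 0]}"
  then have "cubic_vec s \<in> vec.span {vector [1, 0, 0, 0]}" using vec.span_base by blast
  then show False by (auto simp: vec.span_singleton vec4_eq_iff)
qed

text \<open>Points are replaced by parameters: distinct \<open>t\<close> give distinct points of the
  cubic, and (1,0,0,0) is the one point without a parameter.\<close>

lemma card_cubic_points_on:
  fixes S :: "('a::{field,finite} ^ 4) set"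
  assumes S: "vec.subspace S"
  shows "card (cubic_points_on S) =
    card {t. cubic_vec t \<in> S} + (if vector [1, 0, 0, 0] \<in> S then 1 else 0)"
proof -
  let ?f = "\<lambda>t::'a. vec.span {cubic_vec t}" and ?e = "vec.span {vector [1, 0, 0, 0]} :: ('a ^ 4) set"
  have *: "cubic_points_on S = ?f ` {t. cubic_vec t \<in> S} \<union> (if vector [1, 0, 0, 0] \<in> S then {?e} else {})"
    unfolding cubic_points_on_def twisted_cubic_eq using span_single_subset_iff[OF S] by auto
  have "card (?f ` {t. cubic_vec t \<in> S}) = card {t. cubic_vec t \<in> S}"
    by (rule card_image) (auto simp: inj_on_def)
  moreover have "?e \<notin> ?f ` {t. cubic_vec t \<in> S}" using cubic_vec_span_neq by blast
  ultimately show ?thesis unfolding * by (simp add: card_insert_if)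
qed

section \<open>Frobenius in a finite field of characteristic 3\<close>

locale char_3_field =
  fixes field_type :: "'a::{field,finite} itself"
  assumes three_eq_0 [simp]: "(3 :: 'a) = 0"
    and card_ge: "CARD('a) \<ge> 9"
begin

lemma two_eq: "(2 :: 'a) = - 1"
  by (simp add: eq_neg_iff_add_eq_0)

lemma two_neq_0 [simp]: "(2 :: 'a) \<noteq> 0"
  unfolding two_eq by simp

lemma cube_add: "(x + y) ^ 3 = x ^ 3 + y ^ 3" for x y :: 'a
proof -
  have "(x + y) ^ 3 = x ^ 3 + y ^ 3 + 3 * (x\<^sup>2 * y + x * y\<^sup>2)"
    by (simp add: power3_eq_cube power2_eq_square algebra_simps del: three_eq_0)
  then show ?thesis by simp
qed

lemma cube_minus: "(- x) ^ 3 = - (x ^ 3)" for x :: 'a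
  by (simp add: power3_eq_cube)

lemma cube_diff: "(x - y) ^ 3 = x ^ 3 - y ^ 3" for x y :: 'a
  using cube_add[of x "- y"] by (simp add: cube_minus)

lemma cube_eq_iff: "x ^ 3 = y ^ 3 \<longleftrightarrow> x = y" for x y :: 'a
  using cube_diff[of x y] by auto

text \<open>An injective map of a finite field into itself is onto. The cube roots obtained here
  give the parameter of an osculating plane and the scaling factor that normalises a line.\<close>

lemma surj_cube: "\<exists>x. x ^ 3 = (y :: 'a)"
proof -
  have "surj (\<lambda>x :: 'a. x ^ 3)"
    by (rule finite_UNIV_inj_surj) (auto simp: inj_def cube_eq_iff)
  then show ?thesis by (metis surjD)
qed

subsection \<open>The axis\<close>

text \<open>The middle coefficients of the osculating planes vanish, which leaves the planes x3 = 0
  and x0 = t^3 x3; the first of them together with any other has this intersection.\<close>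

lemma axis_eq: "(axis :: ('a ^ 4) set) = {x. x $ 1 = 0 \<and> x $ 4 = 0}"
proof -
  have Gamma: "(Gamma_planes :: ('a ^ 4) set set) = insert (plane 0 0 0 1) (range (\<lambda>t. plane 1 0 0 (- (t ^ 3))))"
    by (simp add: Gamma_planes_def)
  have axis: "(axis :: ('a ^ 4) set) = plane 0 0 0 1 \<inter> (\<Inter>t. plane 1 0 0 (- (t ^ 3)))"
    unfolding axis_def Gamma Inter_insert by (rule refl)
  show ?thesis unfolding axis by (auto simp: plane_def)
qed

lemma dim_axis: "vec.dim (axis :: ('a ^ 4) set) = 2"
  and subspace_axis: "vec.subspace (axis :: ('a ^ 4) set)"
proof -
  have axis_span: "(axis :: ('a ^ 4) set) = vec.span {vector [0, 1, 0, 0], vector [0, 0, 1, 0]}"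
  proof (intro equalityI subsetI)
    fix x :: "'a ^ 4" assume "x \<in> axis"
    then have "x = x $ 2 *s vector [0, 1, 0, 0] + x $ 3 *s vector [0, 0, 1, 0]"
      by (simp add: axis_eq vec4_eq_iff)
    then show "x \<in> vec.span {vector [0, 1, 0, 0], vector [0, 0, 1, 0]}"
      by (metis insertI1 insertI2 vec.span_add vec.span_base vec.span_scale)
  qed (auto simp: vec.span_insert axis_eq vec.span_singleton vec4_eq_iff algebra_simps)
  show "vec.dim (axis :: ('a ^ 4) set) = 2"
    unfolding axis_span by (rule dim_span_pair) (auto simp: vec.span_singleton vec4_eq_iff)
  show "vec.subspace (axis :: ('a ^ 4) set)"
    unfolding axis_span by (rule vec.subspace_span)
qed

lemma cubic_matrices_axis:
  fixes A :: "'a ^ 4 ^ 4"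
  assumes A: "A \<in> cubic_matrices"
  shows "act A axis = axis"
proof -
  have inv: "invertible A" using A by (rule cubic_matricesD)
  have surj: "\<exists>v. A *v v = w" for w
    using inv by (metis invertible_def matrix_vector_mul_assoc matrix_vector_mul_lid)
  \<comment> \<open>These are the row polynomials f0, ..., f3. A coefficient list starts with the
    constant term, so column 4 of \<open>A\<close> comes first and column 1 is the coefficient of
    t^3.\<close>
  define p where "p i = [:A $ i $ 4, A $ i $ 3, A $ i $ 2, A $ i $ 1:]" for i
  have poly_p: "poly (p i) t = (A *v cubic_vec t) $ i" for i t
    by (simp add: p_def matrix_vector_mult_def sum_4 power2_eq_square power3_eq_cube algebra_simps)
  have deg: "degree (p i) \<le> 3" for i
    unfolding p_def by (intro degree_pCons_le order.refl | simp add: degree_pCons_eq_if)+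
  have zero: "r = 0" if "degree r \<le> 6" "\<And>t. poly r t = 0" for r :: "'a poly"
  proof (rule ccontr)
    assume "r \<noteq> 0"
    then have "card {t. poly r t = 0} \<le> degree r" by (rule card_poly_roots_bound)
    then show False using that card_ge by simp
  qed
  have cone: "on_cubic_cone (A *v cubic_vec t)" for t
    by (rule cubic_matrices_cone[OF A]) (simp add: on_cubic_cone_def power2_eq_square power3_eq_cube)
  have "degree (p i * p j) \<le> 6" for i j
    using degree_mult_le[of "p i" "p j"] deg[of i] deg[of j] by linarith
  then have deg2: "degree (p i * p j - p k * p l) \<le> 6" for i j k l
    by (intro degree_diff_le)
  have e1: "p 1 * p 3 - p 2 * p 2 = 0"
    by (rule zero[OF deg2]) (use cone in \<open>simp add: poly_p on_cubic_cone_def power2_eq_square\<close>)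
  have e2: "p 1 * p 4 - p 2 * p 3 = 0"
    by (rule zero[OF deg2]) (use cone in \<open>simp add: poly_p on_cubic_cone_def power2_eq_square\<close>)
  have "p 1 * p 1 * p 4 = p 1 * (p 1 * p 4)" by (rule mult.assoc)
  also have "\<dots> = p 2 * (p 1 * p 3)" using e2 by (simp only: right_minus_eq mult.left_commute)
  also have "\<dots> = p 2 * p 2 * p 2" using e1 by simp
  finally have cube: "p 1 * p 1 * p 4 = p 2 * p 2 * p 2" .
  \<comment> \<open>Otherwise every image under \<open>A\<close> would lie in the plane x0 = 0,
    against surjectivity.\<close>
  have nz: "p 1 \<noteq> 0"
  proof
    assume "p 1 = 0"
    then have "(A *v v) $ 1 = 0" for v
      by (simp add: p_def matrix_vector_mult_def sum_4)
    then show False using surj[of "vector [1,0,0,0]"] by (metis vector_4(1) zero_neq_one)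
  qed
  have three_poly: "(3 :: 'a poly) = 0" 
    using of_nat_poly[of 3, where 'a = 'a] by simp
  have "pderiv (p 2 * p 2 * p 2) = 3 * (p 2 * p 2 * pderiv (p 2))"
    by (simp add: pderiv_mult algebra_simps del: three_eq_0)
  then have "pderiv (p 1 * p 1 * p 4) = 0" unfolding cube three_poly by simp
  then have "p 1 * (p 1 * pderiv (p 4) + 2 * (pderiv (p 1) * p 4)) = 0"
    by (simp add: pderiv_mult algebra_simps)
  then have "p 1 * pderiv (p 4) + 2 * (pderiv (p 1) * p 4) = 0" using nz by simp
  \<comment> \<open>Subtracting three times a product, which is zero, turns the coefficient 2 into
    -1 and the expression into the Wronskian of \<open>p 1\<close> and \<open>p 4\<close>.\<close>
  then have W: "p 1 * pderiv (p 4) + 2 * (pderiv (p 1) * p 4) - 3 * (pderiv (p 1) * p 4) = 0"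
    using three_poly by simp
  have "p 1 * pderiv (p 4) - pderiv (p 1) * p 4 = 0"
    using W by (simp add: algebra_simps del: three_eq_0)
  \<comment> \<open>In characteristic 3 a derivative retains only the coefficients of t and t^2,
    that is, columns 3 and 2. The coefficients of the Wronskian are, up to sign and a factor 2, the
    2x2 minors of rows 1 and 4 that involve one of these columns.\<close>
  then have W: "A $ 1 $ i * A $ 4 $ j = A $ 4 $ i * A $ 1 $ j" if "i \<in> {2, 3}" for i j
    using that exhaust_4[of j]
    by (auto simp: p_def pderiv_pCons algebra_simps)
  have "A $ 1 $ i = 0 \<and> A $ 4 $ i = 0" if i: "i \<in> {2, 3}" for i
  proof -
    have *: "A $ 1 $ i * (A *v v) $ 4 = A $ 4 $ i * (A *v v) $ 1" for v
      using W[OF i] by (simp add: matrix_vector_mult_def sum_distrib_left mult.assoc[symmetric])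
    \<comment> \<open>As \<open>*\<close> is linear in the image of \<open>v\<close>, its values at
      the images (1,0,0,0) and (0,0,0,1) isolate the two entries.\<close>
    obtain v w where "A *v v = vector [1, 0, 0, 0]" "A *v w = vector [0, 0, 0, 1]"
      using surj by metis
    then show ?thesis using *[of v] *[of w] by simp
  qed
  then have "act A axis \<subseteq> axis"
    by (auto simp: act_def axis_eq matrix_vector_mult_def sum_4)
  then show ?thesis
    by (rule subspace_eq_of_dim_le[OF subspace_act[OF subspace_axis] subspace_axis])
      (simp add: dim_act inv)
qed

end

section \<open>Explicit matrices that preserve the cubic\<close>

lemma invertibleI:
  fixes A B :: "'a::field ^ 4 ^ 4"
  assumes "\<And>v. B *v (A *v v) = v"
  shows "invertible A"
proof -
  have "B ** A = mat 1" using assms by (simp add: matrix_eq matrix_vector_mul_assoc[symmetric])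
  then show ?thesis using invertible_left_inverse by blast
qed

text \<open>These matrices induce \<open>t \<mapsto> t + b\<close> (with \<open>2 = - 1\<close> and \<open>3 = 0\<close> already used), \<open>t \<mapsto> a t\<close> and
  \<open>t \<mapsto> 1 / t\<close> on the cubic.\<close>

definition shift_matrix :: "'a::field \<Rightarrow> 'a ^ 4 ^ 4" where
  "shift_matrix b =
    vector [vector [1, 0, 0, b ^ 3], vector [0, 1, - b, b ^ 2], vector [0, 0, 1, b], vector [0, 0, 0, 1]]"

definition scale_matrix :: "'a::field \<Rightarrow> 'a ^ 4 ^ 4" where
  "scale_matrix a =
    vector [vector [a ^ 3, 0, 0, 0], vector [0, a ^ 2, 0, 0], vector [0, 0, a, 0], vector [0, 0, 0, 1]]"

definition swap_matrix :: "'a::field ^ 4 ^ 4" where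
  "swap_matrix =
    vector [vector [0, 0, 0, 1], vector [0, 0, 1, 0], vector [0, 1, 0, 0], vector [1, 0, 0, 0]]"

lemma shift_matrix_nth:
  "(shift_matrix b *v x) $ 1 = x $ 1 + b ^ 3 * x $ 4"
  "(shift_matrix b *v x) $ 2 = x $ 2 - b * x $ 3 + b ^ 2 * x $ 4"
  "(shift_matrix b *v x) $ 3 = x $ 3 + b * x $ 4"
  "(shift_matrix b *v x) $ 4 = x $ 4"
  by (simp_all add: shift_matrix_def matrix_vector_mult_def sum_4)

lemma scale_matrix_nth:
  "(scale_matrix a *v x) $ 1 = a ^ 3 * x $ 1" "(scale_matrix a *v x) $ 2 = a ^ 2 * x $ 2"
  "(scale_matrix a *v x) $ 3 = a * x $ 3" "(scale_matrix a *v x) $ 4 = x $ 4"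
  by (simp_all add: scale_matrix_def matrix_vector_mult_def sum_4)

lemma swap_matrix_nth:
  "(swap_matrix *v x) $ 1 = x $ 4" "(swap_matrix *v x) $ 2 = x $ 3"
  "(swap_matrix *v x) $ 3 = x $ 2" "(swap_matrix *v x) $ 4 = x $ 1"
  by (simp_all add: swap_matrix_def matrix_vector_mult_def sum_4)

lemma scale_matrix_in_cubic_matrices:
  fixes a :: "'a::{field,finite}"
  assumes "a \<noteq> 0"
  shows "scale_matrix a \<in> cubic_matrices"
proof (rule cubic_matricesI)
  have "scale_matrix (1 / a) *v (scale_matrix a *v v) = v" for v
    using assms by (simp add: vec4_eq_iff scale_matrix_nth power_divide)
  then show "invertible (scale_matrix a)" by (rule invertibleI)
qed (auto simp: on_cubic_cone_def scale_matrix_nth power2_eq_square power3_eq_cube)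

lemma swap_matrix_in_cubic_matrices: "(swap_matrix :: 'a::{field,finite} ^ 4 ^ 4) \<in> cubic_matrices"
proof (rule cubic_matricesI)
  have "swap_matrix *v (swap_matrix *v v) = v" for v :: "'a ^ 4"
    by (simp add: vec4_eq_iff swap_matrix_nth)
  then show "invertible (swap_matrix :: 'a ^ 4 ^ 4)" by (rule invertibleI)
qed (auto simp: on_cubic_cone_def swap_matrix_nth mult.commute)

lemma act_eqI:
  fixes L L' :: "('a::field ^ 4) set"
  assumes "invertible A" "vec.subspace L" "vec.subspace L'" "vec.dim L = vec.dim L'"
    "\<And>x. x \<in> L \<Longrightarrow> A *v x \<in> L'"
  shows "act A L = L'"
  using assms by (intro subspace_eq_of_dim_le subspace_act) (auto simp: dim_act, auto simp: act_def)

subsection \<open>Lines and planes through a point of the axis\<close>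

definition axis_point :: "'a::field ^ 4" where
  "axis_point = vector [0, 1, 0, 0]"

definition plane_through :: "'a::field \<Rightarrow> 'a \<Rightarrow> ('a ^ 4) set" where
  "plane_through \<alpha> \<beta> = {x. x $ 3 = \<alpha> * x $ 1 + \<beta> * x $ 4}"

text \<open>The join of \<open>axis_point\<close> and P(u,0,v,1); the coordinate x1 is free.\<close>

definition line_through :: "'a::field \<Rightarrow> 'a \<Rightarrow> ('a ^ 4) set" where
  "line_through u v = {x. x $ 1 = u * x $ 4 \<and> x $ 3 = v * x $ 4}"

text \<open>The join of \<open>axis_point\<close> and P(1,0,v,0). Nonzero squares and non-squares
  \<open>v\<close> will give the two small orbits.\<close>

definition line_at_inf :: "'a::field \<Rightarrow> ('a ^ 4) set" where
  "line_at_inf v = {x. x $ 4 = 0 \<and> x $ 3 = v * x $ 1}"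

lemma axis_point_nth [simp]:
  "axis_point $ 1 = 0" "axis_point $ 2 = 1" "axis_point $ 3 = 0" "axis_point $ 4 = 0"
  by (simp_all add: axis_point_def)

lemma plane_through_eq: "plane_through \<alpha> \<beta> = plane \<alpha> 0 (- 1) \<beta>"
  by (auto simp: plane_through_def plane_def algebra_simps)

lemma plane_through_in_pg_planes: "plane_through \<alpha> \<beta> \<in> pg_planes"
  unfolding plane_through_eq by (rule plane_in_pg_planes) simp

lemma pair_span_in_pg_lines:
  fixes x y :: "'a::field ^ 4"
  assumes "y \<noteq> 0" "x \<notin> vec.span {y}"
  shows "vec.span {x, y} \<in> pg_lines"
  using dim_span_pair[OF assms] by (simp add: pg_lines_def)

lemma in_span_pair_iff: "z \<in> vec.span {x, y} \<longleftrightarrow> (\<exists>k l. z = k *s x + l *s y)"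
  for x y z :: "'a::field ^ 4"
  by (simp add: vec.span_insert vec.span_singleton image_iff diff_eq_eq add.commute)

lemma line_through_in_pg_lines: "line_through u v \<in> pg_lines"
proof -
  have "line_through u v = vec.span {axis_point, vector [u, 0, v, 1]}"
    by (auto simp: line_through_def in_span_pair_iff vec4_eq_iff mult.commute)
  moreover have "vec.span {axis_point, vector [u, 0, v, 1]} \<in> pg_lines"
    by (rule pair_span_in_pg_lines) (auto simp: vec.span_singleton vec4_eq_iff)
  ultimately show ?thesis by simp
qed

lemma line_at_inf_in_pg_lines: "line_at_inf v \<in> pg_lines"
proof -
  have "line_at_inf v = vec.span {axis_point, vector [1, 0, v, 0]}"
    by (auto simp: line_at_inf_def in_span_pair_iff vec4_eq_iff mult.commute)
  moreover have "vec.span {axis_point, vector [1, 0, v, 0]} \<in> pg_lines"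
    by (rule pair_span_in_pg_lines) (auto simp: vec.span_singleton vec4_eq_iff)
  ultimately show ?thesis by simp
qed

lemma pg_linesD: "L \<in> pg_lines \<Longrightarrow> vec.subspace L" "L \<in> pg_lines \<Longrightarrow> vec.dim L = 2"
  by (simp_all add: pg_lines_def)

lemma pg_planesD: "S \<in> pg_planes \<Longrightarrow> vec.subspace S" "S \<in> pg_planes \<Longrightarrow> vec.dim S = 3"
  by (simp_all add: pg_planes_def)

lemma pg_lines_eqI: "L \<in> pg_lines \<Longrightarrow> L' \<in> pg_lines \<Longrightarrow> L \<subseteq> L' \<Longrightarrow> L = L'"
  by (rule subspace_eq_of_dim_le) (auto simp: pg_lines_def)

lemma line_through_subset_iff: "line_through u v \<subseteq> plane_through \<alpha> \<beta> \<longleftrightarrow> v = \<alpha> * u + \<beta>"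
proof
  assume "line_through u v \<subseteq> plane_through \<alpha> \<beta>"
  moreover have "vector [u, 0, v, 1] \<in> line_through u v" by (simp add: line_through_def)
  ultimately have "vector [u, 0, v, 1] \<in> plane_through \<alpha> \<beta>" by blast
  then show "v = \<alpha> * u + \<beta>" by (simp add: plane_through_def)
qed (auto simp: line_through_def plane_through_def algebra_simps)

lemma line_at_inf_subset_iff: "line_at_inf v \<subseteq> plane_through \<alpha> \<beta> \<longleftrightarrow> v = \<alpha>"
proof
  assume "line_at_inf v \<subseteq> plane_through \<alpha> \<beta>"
  moreover have "vector [1, 0, v, 0] \<in> line_at_inf v" by (simp add: line_at_inf_def)
  ultimately have "vector [1, 0, v, 0] \<in> plane_through \<alpha> \<beta>" by blast
  then show "v = \<alpha>" by (simp add: plane_through_def)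
qed (auto simp: line_at_inf_def plane_through_def)

lemma line_through_eq_iff [simp]: "line_through u v = line_through u' v' \<longleftrightarrow> u = u' \<and> v = v'"
proof
  assume "line_through u v = line_through u' v'"
  moreover have "vector [u, 0, v, 1] \<in> line_through u v" by (simp add: line_through_def)
  ultimately have "vector [u, 0, v, 1] \<in> line_through u' v'" by blast
  then show "u = u' \<and> v = v'" by (simp add: line_through_def)
qed simp

lemma line_at_inf_eq_iff [simp]: "line_at_inf v = line_at_inf v' \<longleftrightarrow> v = v'"
proof
  assume "line_at_inf v = line_at_inf v'"
  moreover have "vector [1, 0, v, 0] \<in> line_at_inf v" by (simp add: line_at_inf_def)
  ultimately have "vector [1, 0, v, 0] \<in> line_at_inf v'" by blast
  then show "v = v'" by (simp add: line_at_inf_def)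
qed simp

lemma line_through_neq_line_at_inf [simp]: "line_through u v \<noteq> line_at_inf w"
proof
  assume "line_through u v = line_at_inf w"
  moreover have "vector [u, 0, v, 1] \<in> line_through u v" by (simp add: line_through_def)
  ultimately have "vector [u, 0, v, 1] \<in> line_at_inf w" by blast
  then show False by (simp add: line_at_inf_def)
qed

lemma plane_through_eq_iff [simp]: "plane_through \<alpha> \<beta> = plane_through \<alpha>' \<beta>' \<longleftrightarrow> \<alpha> = \<alpha>' \<and> \<beta> = \<beta>'"
proof
  assume *: "plane_through \<alpha> \<beta> = plane_through \<alpha>' \<beta>'"
  have "vector [1, 0, \<alpha>, 0] \<in> plane_through \<alpha> \<beta>" "vector [0, 0, \<beta>, 1] \<in> plane_through \<alpha> \<beta>"
    by (simp_all add: plane_through_def)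
  then show "\<alpha> = \<alpha>' \<and> \<beta> = \<beta>'" unfolding * by (simp add: plane_through_def)
qed simp

lemma axis_point_mem [simp]:
  "axis_point \<in> line_through u v" "axis_point \<in> line_at_inf v" "axis_point \<in> plane_through \<alpha> \<beta>"
  by (simp_all add: line_through_def line_at_inf_def plane_through_def)

text \<open>The summand 1 accounts for (1,0,0,0), which satisfies the equation of the plane exactly
  if \<alpha> = 0.\<close>

lemma card_cubic_points_on_plane_through:
  fixes \<alpha> \<beta> :: "'a::{field,finite}"
  shows "card (cubic_points_on (plane_through \<alpha> \<beta>)) =
    card {t. t = \<alpha> * t ^ 3 + \<beta>} + (if \<alpha> = 0 then 1 else 0)"
  unfolding card_cubic_points_on[OF pg_planesD(1)[OF plane_through_in_pg_planes]]
  by (simp add: plane_through_def)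

lemma cubic_points_on_empty_iff:
  assumes "vec.subspace S"
  shows "cubic_points_on S = {} \<longleftrightarrow> (\<forall>t. cubic_vec t \<notin> S) \<and> vector [1, 0, 0, 0] \<notin> S"
proof -
  have "cubic_points_on S = {} \<longleftrightarrow> (\<forall>p \<in> twisted_cubic. \<not> p \<subseteq> S)"
    by (auto simp: cubic_points_on_def)
  also have "\<dots> \<longleftrightarrow> (\<forall>t. \<not> vec.span {cubic_vec t} \<subseteq> S) \<and> \<not> vec.span {vector [1, 0, 0, 0]} \<subseteq> S"
    unfolding twisted_cubic_eq by blast
  finally show ?thesis unfolding span_single_subset_iff[OF assms] .
qed

text \<open>Planes that contain the axis are the osculating planes, so this covers the one-point
  planes that are not osculating (d = 1) and the planes with 0, 2 or 3 cubic points in one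
  definition.\<close>

definition plane_class :: "nat \<Rightarrow> ('a::field ^ 4) set set" where
  "plane_class d = {S \<in> pg_planes. \<not> axis \<subseteq> S \<and> card (cubic_points_on S) = d}"

context char_3_field
begin

text \<open>Each quadric, evaluated at the image of \<open>v\<close>, is a combination of the three
  quadrics at \<open>v\<close> plus a multiple of 3. The inverse is the shift by \<open>- b\<close>,
  again up to a multiple of 3.\<close>

lemma shift_matrix_in_cubic_matrices: "shift_matrix (b :: 'a) \<in> cubic_matrices"
proof (rule cubic_matricesI)
  have "shift_matrix (- b) *v (shift_matrix b *v v) = v" for v
  proof -
    have "v $ 2 - b * v $ 3 + b\<^sup>2 * v $ 4 + b * (v $ 3 + b * v $ 4) + b\<^sup>2 * v $ 4 = v $ 2 + 3 * (b\<^sup>2 * v $ 4)"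
      by (simp add: algebra_simps power2_eq_square del: three_eq_0)
    then show ?thesis by (simp add: vec4_eq_iff shift_matrix_nth cube_minus)
  qed
  then show "invertible (shift_matrix b)" by (rule invertibleI)
next
  fix v :: "'a ^ 4"
  assume "on_cubic_cone v"
  then have v: "v $ 1 * v $ 3 - v $ 2 ^ 2 = 0" "v $ 2 * v $ 4 - v $ 3 ^ 2 = 0"
    "v $ 1 * v $ 4 - v $ 2 * v $ 3 = 0"
    by (auto simp: on_cubic_cone_def)
  have "(x1 + b ^ 3 * x4) * (x3 + b * x4) - (x2 - b * x3 + b\<^sup>2 * x4)\<^sup>2 =
    (x1 * x3 - x2 ^ 2) + b * (x1 * x4 - x2 * x3) - 2 * b ^ 2 * (x2 * x4 - x3 ^ 2) +
    3 * (b * x2 * x3 + b ^ 3 * x3 * x4 - b ^ 2 * x3 ^ 2)" for x1 x2 x3 x4 :: 'a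
    by algebra
  from this[of "v $ 1" "v $ 4" "v $ 3" "v $ 2"]
  have 1: "(v $ 1 + b ^ 3 * v $ 4) * (v $ 3 + b * v $ 4) - (v $ 2 - b * v $ 3 + b\<^sup>2 * v $ 4)\<^sup>2 = 0"
    by (simp only: v three_eq_0 mult_zero_left mult_zero_right add_0 diff_0_right)
  have "(x2 - b * x3 + b\<^sup>2 * x4) * x4 - (x3 + b * x4)\<^sup>2 =
    (x2 * x4 - x3 ^ 2) - 3 * (b * x3 * x4)" for x2 x3 x4 :: 'a
    by algebra
  from this[of "v $ 2" "v $ 3" "v $ 4"]
  have 2: "(v $ 2 - b * v $ 3 + b\<^sup>2 * v $ 4) * v $ 4 - (v $ 3 + b * v $ 4)\<^sup>2 = 0"
    by (simp only: v three_eq_0 mult_zero_left mult_zero_right diff_0_right)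
  have "(x1 + b ^ 3 * x4) * x4 - (x2 - b * x3 + b\<^sup>2 * x4) * (x3 + b * x4) =
    (x1 * x4 - x2 * x3) - b * (x2 * x4 - x3 ^ 2)" for x1 x2 x3 x4 :: 'a
    by algebra
  from this[of "v $ 1" "v $ 4" "v $ 2" "v $ 3"]
  have 3: "(v $ 1 + b ^ 3 * v $ 4) * v $ 4 - (v $ 2 - b * v $ 3 + b\<^sup>2 * v $ 4) * (v $ 3 + b * v $ 4) = 0"
    by (simp only: v mult_zero_right diff_0_right)
  show "on_cubic_cone (shift_matrix b *v v)"
    unfolding on_cubic_cone_def shift_matrix_nth using 1 2 3 by (simp only: right_minus_eq simp_thms)
qed

lemma line_in_EA_iff:
  fixes L :: "('a ^ 4) set"
  shows "L \<in> EA_lines \<longleftrightarrow> L \<in> pg_lines \<and> cubic_points_on L = {} \<and> L \<noteq> axis \<and>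
    (\<exists>x \<in> axis. x \<noteq> 0 \<and> x \<in> L)"
proof -
  have "(\<exists>p \<in> pg_points. p \<subseteq> L \<and> p \<subseteq> axis) \<longleftrightarrow> (\<exists>x \<in> axis. x \<noteq> 0 \<and> x \<in> L)" if L: "L \<in> pg_lines"
  proof
    assume "\<exists>p \<in> pg_points. p \<subseteq> L \<and> p \<subseteq> axis"
    then obtain p where p: "p \<in> pg_points" "p \<subseteq> L" "p \<subseteq> axis" by blast
    then have "\<not> p \<subseteq> {0}" using vec.dim_eq_0[of p] by (auto simp: pg_points_def)
    then show "\<exists>x \<in> axis. x \<noteq> 0 \<and> x \<in> L" using p by blast
  next
    assume "\<exists>x \<in> axis. x \<noteq> 0 \<and> x \<in> L"
    then obtain x where x: "x \<in> axis" "x \<noteq> 0" "x \<in> L" by blast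
    have "vec.span {x} \<in> pg_points" using x by (simp add: pg_points_def vec.dim_insert)
    moreover have "vec.span {x} \<subseteq> L" "vec.span {x} \<subseteq> axis"
      using x L span_single_subset_iff subspace_axis by (auto simp: pg_lines_def)
    ultimately show "\<exists>p \<in> pg_points. p \<subseteq> L \<and> p \<subseteq> axis" by blast
  qed
  then show ?thesis by (auto simp: EA_lines_def)
qed

lemma axis_in_pg_lines: "(axis :: ('a ^ 4) set) \<in> pg_lines"
  by (simp add: pg_lines_def dim_axis subspace_axis)

text \<open>The line is spanned by \<open>axis_point\<close> and a vector \<open>w\<close> off the
  axis. Dividing \<open>w\<close> by its last coordinate, or by its first one if the last is zero,
  gives the two normal forms.\<close>

lemma line_through_axis_point_cases:
  fixes L :: "('a ^ 4) set"
  assumes L: "L \<in> pg_lines" "axis_point \<in> L" "L \<noteq> axis"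
  obtains u v where "L = line_through u v" | v where "L = line_at_inf v"
proof -
  have sub: "vec.subspace L" using L by (simp add: pg_lines_def)
  have mem: "k *s w + l *s axis_point \<in> L" if "w \<in> L" for w k l
    using that L(2) by (intro vec.subspace_add[OF sub] vec.subspace_scale[OF sub])
  have "\<not> L \<subseteq> axis" using L pg_lines_eqI axis_in_pg_lines by blast
  then obtain w where w: "w \<in> L" "w $ 1 \<noteq> 0 \<or> w $ 4 \<noteq> 0" by (auto simp: axis_eq)
  show thesis
  proof (cases "w $ 4 = 0")
    case False
    have "x \<in> L" if "x \<in> line_through (w $ 1 / w $ 4) (w $ 3 / w $ 4)" for x
    proof -
      have "x = (x $ 4 / w $ 4) *s w + (x $ 2 - x $ 4 / w $ 4 * w $ 2) *s axis_point"
        using that False by (simp add: vec4_eq_iff line_through_def)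
      then show ?thesis using mem[OF w(1)] by metis
    qed
    then show thesis using that(1) pg_lines_eqI[OF line_through_in_pg_lines L(1)] by blast
  next
    case True
    have "x \<in> L" if "x \<in> line_at_inf (w $ 3 / w $ 1)" for x
    proof -
      have "x = (x $ 1 / w $ 1) *s w + (x $ 2 - x $ 1 / w $ 1 * w $ 2) *s axis_point"
        using that True w(2) by (simp add: vec4_eq_iff line_at_inf_def)
      then show ?thesis using mem[OF w(1)] by metis
    qed
    then show thesis using that(2) pg_lines_eqI[OF line_at_inf_in_pg_lines L(1)] by blast
  qed
qed

text \<open>On this line x2 = v x3, so the only cubic point that can lie on it is P(v), and it does
  so exactly if u = v^3.\<close>

lemma line_through_in_EA_iff: "line_through u v \<in> EA_lines \<longleftrightarrow> u \<noteq> v ^ 3" for u v :: 'a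
proof -
  have "vector [u, 0, v, 1] \<in> line_through u v" by (simp add: line_through_def)
  then have "line_through u v \<noteq> axis" by (auto simp: axis_eq)
  moreover have "\<exists>x\<in>axis. x \<noteq> 0 \<and> x \<in> line_through u v"
    by (rule bexI[of _ axis_point]) (auto simp: axis_eq vec4_eq_iff)
  moreover have "cubic_points_on (line_through u v) = {} \<longleftrightarrow> u \<noteq> v ^ 3"
    by (auto simp: cubic_points_on_empty_iff pg_linesD(1)[OF line_through_in_pg_lines])
       (auto simp: line_through_def)
  ultimately show ?thesis by (simp add: line_in_EA_iff line_through_in_pg_lines)
qed

text \<open>All points of this line have x3 = 0, so (1,0,0,0) is the only cubic point that can lie
  on it.\<close>

lemma line_at_inf_in_EA_iff: "line_at_inf v \<in> EA_lines \<longleftrightarrow> v \<noteq> 0" for v :: 'a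
proof -
  have "vector [1, 0, v, 0] \<in> line_at_inf v" by (simp add: line_at_inf_def)
  then have "line_at_inf v \<noteq> axis" by (auto simp: axis_eq)
  moreover have "\<exists>x\<in>axis. x \<noteq> 0 \<and> x \<in> line_at_inf v"
    by (rule bexI[of _ axis_point]) (auto simp: axis_eq vec4_eq_iff)
  moreover have "cubic_points_on (line_at_inf v) = {} \<longleftrightarrow> v \<noteq> 0"
    by (auto simp: cubic_points_on_empty_iff pg_linesD(1)[OF line_at_inf_in_pg_lines])
       (auto simp: line_at_inf_def)
  ultimately show ?thesis by (simp add: line_in_EA_iff line_at_inf_in_pg_lines)
qed

text \<open>The point removes x1 from the equation. The coefficient of x2 is then nonzero, as
  otherwise the plane would contain the axis, and the equation can be solved for x2.\<close>

lemma plane_through_axis_point: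
  fixes S :: "('a ^ 4) set"
  assumes S: "S \<in> pg_planes" "\<not> axis \<subseteq> S" "axis_point \<in> S"
  obtains \<alpha> \<beta> where "S = plane_through \<alpha> \<beta>"
proof -
  obtain a b c d where abcd: "S = plane a b c d" using S(1) by (rule pg_planeE)
  have b: "b = 0" using S(3) by (simp add: abcd plane_def)
  have c: "c \<noteq> 0" using S(2) by (auto simp: abcd plane_def axis_eq b)
  have "a * x + c * y + d * z = 0 \<longleftrightarrow> y = - a / c * x + - d / c * z" for x y z
  proof -
    have "y = - a / c * x + - d / c * z \<longleftrightarrow> c * y = c * (- a / c * x + - d / c * z)" using c by simp
    also have "c * (- a / c * x + - d / c * z) = - (a * x + d * z)" using c by (simp add: algebra_simps)
    also have "c * y = - (a * x + d * z) \<longleftrightarrow> c * y + (a * x + d * z) = 0" by (rule eq_neg_iff_add_eq_0)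
    finally show ?thesis by (simp only: ac_simps)
  qed
  then have "S = plane_through (- a / c) (- d / c)"
    by (simp add: abcd plane_def plane_through_def b)
  then show thesis by (rule that)
qed

lemma axis_not_subset_plane_through: "\<not> axis \<subseteq> plane_through \<alpha> (\<beta> :: 'a)"
proof
  have "vector [0, 0, 1, 0] \<in> (axis :: ('a ^ 4) set)" by (simp add: axis_eq)
  moreover assume "axis \<subseteq> plane_through \<alpha> \<beta>"
  ultimately have "vector [0, 0, 1, 0] \<in> plane_through \<alpha> \<beta>" by blast
  then show False by (simp add: plane_through_def)
qed

lemma plane_through_in_plane_class_iff:
  "plane_through \<alpha> (\<beta> :: 'a) \<in> plane_class d \<longleftrightarrow> 
    card {t. t = \<alpha> * t ^ 3 + \<beta>} + (if \<alpha> = 0 then 1 else 0) = d"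
  by (simp add: plane_class_def axis_not_subset_plane_through plane_through_in_pg_planes
      card_cubic_points_on_plane_through)

lemma pg_plane_meets_axis:
  fixes S :: "('a ^ 4) set"
  assumes "S \<in> pg_planes"
  obtains x where "x \<in> axis" "x \<noteq> 0" "x \<in> S"
proof -
  obtain a b c d where S: "S = plane a b c d" using assms by (rule pg_planeE)
  show thesis
  proof (cases "b = 0 \<and> c = 0")
    case True
    then show thesis by (intro that[of axis_point]) (auto simp: S plane_def axis_eq vec4_eq_iff)
  next
    case False
    then show thesis
      by (intro that[of "vector [0, c, - b, 0]"]) (auto simp: S plane_def axis_eq vec4_eq_iff)
  qed
qed

text \<open>A plane on the axis has an equation in x0 and x3 only; a cube root of
  \<open>- d / a\<close> gives the parameter of the osculating plane.\<close>

lemma Gamma_plane_iff: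
  fixes S :: "('a ^ 4) set"
  assumes "S \<in> pg_planes"
  shows "S \<in> Gamma_planes \<longleftrightarrow> axis \<subseteq> S"
proof
  assume "S \<in> Gamma_planes"
  then show "axis \<subseteq> S" unfolding axis_def by (rule Inter_lower)
next
  assume sub: "axis \<subseteq> S"
  obtain a b c d where S: "S = plane a b c d" "a \<noteq> 0 \<or> b \<noteq> 0 \<or> c \<noteq> 0 \<or> d \<noteq> 0"
    using assms by (rule pg_planeE)
  have "vector [0, 1, 0, 0] \<in> S" "vector [0, 0, 1, 0] \<in> S"
    using sub by (auto simp: axis_eq)
  then have bc: "b = 0" "c = 0" by (simp_all add: S plane_def)
  show "S \<in> Gamma_planes"
  proof (cases "a = 0")
    case True
    then have "S = plane 0 0 0 1" using S(2) by (simp add: S(1) bc plane_def)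
    then show ?thesis by (simp add: Gamma_planes_def)
  next
    case False
    obtain t where t: "t ^ 3 = - d / a" using surj_cube by blast
    have "a * x + d * y = 0 \<longleftrightarrow> x + d / a * y = 0" for x y
      using False by (simp add: field_simps)
    then have "S = plane 1 (- 3 * t) (3 * t ^ 2) (- (t ^ 3))"
      by (simp add: S(1) bc plane_def t)
    then show ?thesis by (auto simp: Gamma_planes_def)
  qed
qed

text \<open>The plane x0 = t^3 x3 contains P(t) only, because cubing is injective, and x3 = 0
  contains (1,0,0,0) only. Hence osculating planes matter only for d = 1.\<close>

lemma card_cubic_points_on_Gamma_plane:
  fixes S :: "('a ^ 4) set"
  assumes "S \<in> Gamma_planes"
  shows "card (cubic_points_on S) = 1"
proof -
  consider "S = plane 0 0 0 1" | t where "S = plane 1 0 0 (- (t ^ 3))"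
    using assms by (auto simp: Gamma_planes_def)
  then show ?thesis
  proof cases
    case 1
    then show ?thesis
      by (simp add: card_cubic_points_on subspace_plane) (simp add: plane_def)
  next
    case 2
    then show ?thesis
      by (simp add: card_cubic_points_on subspace_plane) (simp add: plane_def cube_eq_iff)
  qed
qed

lemma dC_planes_eq: "d \<noteq> 1 \<Longrightarrow> (dC_planes d :: ('a ^ 4) set set) = plane_class d"
  using card_cubic_points_on_Gamma_plane by (auto simp: dC_planes_def plane_class_def Gamma_plane_iff)

lemma one_bar_planes_eq: "(one_bar_planes :: ('a ^ 4) set set) = plane_class 1"
  by (auto simp: one_bar_planes_def dC_planes_def plane_class_def Gamma_plane_iff)

text \<open>On the axis the shift by \<open>b\<close> sends (x1, x2) to (x1 - b x2, x2). With b = x1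
  / x2 the first entry vanishes, and the swap then moves the point to
  \<open>axis_point\<close>.\<close>

lemma move_to_axis_point:
  fixes x :: "'a ^ 4"
  assumes "x \<in> axis" "x \<noteq> 0"
  obtains A k where "A \<in> cubic_matrices" "k \<noteq> 0" "A *v x = k *s axis_point"
proof (cases "x $ 3 = 0")
  case True
  \<comment> \<open>\<open>scale_matrix 1\<close> is the identity; the point is already in
    place.\<close>
  show thesis
    by (rule that[of "scale_matrix 1" "x $ 2"])
      (use assms True in \<open>auto simp: axis_eq scale_matrix_in_cubic_matrices vec4_eq_iff scale_matrix_nth\<close>)
next
  case False
  show thesis
    by (rule that[of "swap_matrix ** shift_matrix (x $ 2 / x $ 3)" "x $ 3"])
      (use assms False in \<open>auto simp: axis_eq shift_matrix_in_cubic_matrices swap_matrix_in_cubic_matrices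
        cubic_matrices_mult vec4_eq_iff matrix_vector_mul_assoc[symmetric] shift_matrix_nth swap_matrix_nth\<close>)
qed

lemma move_subspace_to_axis_point:
  fixes S :: "('a ^ 4) set"
  assumes "x \<in> axis" "x \<noteq> 0" "x \<in> S" "vec.subspace S"
  obtains A where "A \<in> cubic_matrices" "axis_point \<in> act A S"
proof -
  obtain A k where A: "A \<in> cubic_matrices" "k \<noteq> 0" "A *v x = k *s axis_point"
    using move_to_axis_point[OF assms(1,2)] .
  have "A *v x \<in> act A S" using assms(3) by (auto simp: act_def)
  then have "k *s axis_point \<in> act A S" by (simp only: A(3))
  then have "(1 / k) *s (k *s axis_point) \<in> act A S"
    using subspace_act[OF assms(4)] vec.subspace_scale by blast
  then have "axis_point \<in> act A S" using A(2) by simp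
  then show thesis using A(1) that by blast
qed

lemma plane_class_act:
  fixes A :: "'a ^ 4 ^ 4"
  assumes A: "A \<in> cubic_matrices" and S: "S \<in> plane_class d"
  shows "act A S \<in> plane_class d"
proof -
  have "axis \<subseteq> act A S \<longleftrightarrow> axis \<subseteq> S"
    using act_subset_iff[OF cubic_matricesD[OF A], of axis S] cubic_matrices_axis[OF A] by simp
  then show ?thesis
    using S card_cubic_points_on_act[OF A]
    by (simp add: plane_class_def pg_planes_def subspace_act dim_act cubic_matricesD[OF A])
qed

lemma EA_lines_act:
  fixes A :: "'a ^ 4 ^ 4"
  assumes A: "A \<in> cubic_matrices" and L: "L \<in> EA_lines"
  shows "act A L \<in> EA_lines"
proof -
  have inv: "invertible A" using A by (rule cubic_matricesD)
  obtain x where x: "x \<in> axis" "x \<noteq> 0" "x \<in> L" using L by (auto simp: line_in_EA_iff)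
  have "act A L \<noteq> axis"
    using L act_eq_iff[OF inv, of L axis] cubic_matrices_axis[OF A] by (auto simp: line_in_EA_iff)
  moreover have "A *v x \<in> axis" using x(1) cubic_matrices_axis[OF A] by (auto simp: act_def)
  moreover have "A *v x \<noteq> 0" using x(2) inv by (simp add: invertible_mult_eq_0_iff)
  moreover have "A *v x \<in> act A L" using x(3) by (auto simp: act_def)
  moreover have "cubic_points_on (act A L) = {}"
    using L by (simp add: cubic_points_on_act[OF A] line_in_EA_iff)
  moreover have "act A L \<in> pg_lines"
    using L by (simp add: line_in_EA_iff pg_lines_def subspace_act dim_act inv)
  ultimately show ?thesis by (auto simp: line_in_EA_iff)
qed

end

section \<open>Squares and roots of additive cubic equations\<close>

lemma card_eq_fibre_card_mult:
  assumes "finite A" "\<And>x. x \<in> A \<Longrightarrow> card {y \<in> A. f y = f x} = k"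
  shows "card A = k * card (f ` A)"
proof -
  have "card A = (\<Sum>x\<in>A. 1)" by simp
  also have "\<dots> = (\<Sum>y\<in>f ` A. \<Sum>x\<in>{x \<in> A. f x = y}. 1)"
    by (rule sum.image_gen[OF assms(1)])
  also have "\<dots> = (\<Sum>y\<in>f ` A. k)"
    by (rule sum.cong) (use assms(2) in auto)
  finally show ?thesis by simp
qed

definition nonzero_squares :: "'a::field set" where
  "nonzero_squares = (\<lambda>s. s ^ 2) ` (UNIV - {0})"

text \<open>The parameters of the cubic points of \<open>plane_through \<alpha> \<beta>\<close>
  other than (1,0,0,0).\<close>

definition plane_params :: "'a::field \<Rightarrow> 'a \<Rightarrow> 'a set" where
  "plane_params \<alpha> \<beta> = {t. t = \<alpha> * t ^ 3 + \<beta>}"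

text \<open>The image of the additive Artin-Schreier map, whose kernel is the prime field; it
  decides which planes with \<alpha> = 1 have cubic points.\<close>

definition artin_schreier_image :: "'a::field set" where
  "artin_schreier_image = range (\<lambda>t. t - t ^ 3)"

context char_3_field
begin

lemma neg_eq_self_iff [simp]: "- x = x \<longleftrightarrow> x = 0" "x = - x \<longleftrightarrow> x = 0" for x :: 'a
proof -
  have "- x = x \<longleftrightarrow> 2 * x = 0"
    unfolding mult_2 by (rule neg_eq_iff_add_eq_0)
  then show *: "- x = x \<longleftrightarrow> x = 0" by simp
  show "x = - x \<longleftrightarrow> x = 0" unfolding *[symmetric] by (rule eq_commute)
qed

lemma zero_notin_nonzero_squares [simp]: "(0 :: 'a) \<notin> nonzero_squares"
  by (auto simp: nonzero_squares_def)

lemma card_square_fibre: "card {y \<in> UNIV - {0}. y ^ 2 = x ^ 2} = 2" if "x \<noteq> 0" for x :: 'a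
proof -
  have "{y \<in> UNIV - {0}. y ^ 2 = x ^ 2} = {x, - x}"
    using that by (auto simp: power2_eq_iff)
  then show ?thesis using that by simp
qed

lemma card_nonzero_squares: "2 * card (nonzero_squares :: 'a set) = CARD('a) - 1"
proof -
  have "card (UNIV - {0 :: 'a}) = 2 * card (nonzero_squares :: 'a set)"
    unfolding nonzero_squares_def by (rule card_eq_fibre_card_mult) (auto simp: card_square_fibre[simplified])
  then show ?thesis by (simp add: card_Diff_singleton)
qed

lemma card_nonsquares: "2 * card {x :: 'a. x \<noteq> 0 \<and> x \<notin> nonzero_squares} = CARD('a) - 1"
proof -
  have eq: "{x :: 'a. x \<noteq> 0 \<and> x \<notin> nonzero_squares} = (UNIV - {0}) - nonzero_squares" by auto
  have "card {x :: 'a. x \<noteq> 0 \<and> x \<notin> nonzero_squares} = (CARD('a) - 1) - card (nonzero_squares :: 'a set)"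
    unfolding eq by (subst card_Diff_subset) (auto simp: card_Diff_singleton)
  then show ?thesis using card_nonzero_squares by linarith
qed

text \<open>Multiplication by the non-square \<open>y\<close> maps the nonzero squares injectively
  into the non-squares, and both sets have (q - 1) / 2 elements.\<close>

lemma nonsquare_ratio:
  fixes x y :: 'a
  assumes "x \<noteq> 0" "x \<notin> nonzero_squares" "y \<noteq> 0" "y \<notin> nonzero_squares"
  obtains s where "s \<noteq> 0" "x = y * s ^ 2"
proof -
  let ?N = "{x :: 'a. x \<noteq> 0 \<and> x \<notin> nonzero_squares}"
  have inj: "inj_on ((*) y) nonzero_squares" using assms(3) by (simp add: inj_on_def)
  have "(*) y ` nonzero_squares \<subseteq> ?N"
  proof (rule image_subsetI)
    fix z :: 'a
    assume "z \<in> nonzero_squares"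
    then obtain s where s: "z = s ^ 2" "s \<noteq> 0" by (auto simp: nonzero_squares_def)
    have "y * s ^ 2 \<notin> nonzero_squares"
    proof
      assume "y * s ^ 2 \<in> nonzero_squares"
      then obtain r where r: "y * s ^ 2 = r ^ 2" by (auto simp: nonzero_squares_def)
      then have "y = (r / s) ^ 2" using s by (simp add: power_divide field_simps)
      moreover have "r / s \<noteq> 0" using r s assms(3) by auto
      ultimately show False using assms(4) by (auto simp: nonzero_squares_def)
    qed
    then show "y * z \<in> ?N" using s assms(3) by simp
  qed
  moreover have "card ((*) y ` nonzero_squares) = card ?N"
    using card_image[OF inj] card_nonzero_squares card_nonsquares by linarith
  ultimately have "(*) y ` nonzero_squares = ?N" by (intro card_subset_eq) auto
  then have "x \<in> (*) y ` nonzero_squares" using assms by blast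
  then show thesis using that by (auto simp: nonzero_squares_def)
qed

text \<open>The fibres of t - t^3 are the cosets {t, t + 1, t - 1} of the prime field.\<close>

lemma card_artin_schreier_image: "3 * card (artin_schreier_image :: 'a set) = CARD('a)"
proof -
  have "card {s \<in> UNIV. s - s ^ 3 = t - t ^ 3} = 3" for t :: 'a
  proof -
    have "s - s ^ 3 = t - t ^ 3 \<longleftrightarrow> s \<in> {t, t + 1, t - 1}" for s
    proof -
      have "s - s ^ 3 = t - t ^ 3 \<longleftrightarrow> (s - t) - (s - t) ^ 3 = 0"
        unfolding cube_diff by (auto simp: algebra_simps)
      also have "(s - t) - (s - t) ^ 3 = (s - t) * (1 - (s - t)) * (1 + (s - t))"
        by algebra
      also have "\<dots> = 0 \<longleftrightarrow> s - t = 0 \<or> 1 - (s - t) = 0 \<or> 1 + (s - t) = 0"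
        by (simp only: mult_eq_0_iff disj_assoc)
      also have "1 - (s - t) = (t + 1) - s" by simp
      also have "1 + (s - t) = s - (t - 1)" by simp
      finally show ?thesis unfolding right_minus_eq by blast
    qed
    then have "{s \<in> UNIV. s - s ^ 3 = t - t ^ 3} = {t, t + 1, t - 1}" by blast
    moreover have "t + 1 \<noteq> t - 1"
      using neg_eq_self_iff(2)[of "1 :: 'a"] by (simp add: diff_conv_add_uminus del: add_uminus_conv_diff)
    ultimately show ?thesis by simp
  qed
  then have "card (UNIV :: 'a set) = 3 * card (artin_schreier_image :: 'a set)"
    unfolding artin_schreier_image_def by (intro card_eq_fibre_card_mult) simp_all
  then show ?thesis by simp
qed

lemma mem_plane_params_iff: "t \<in> plane_params \<alpha> \<beta> \<longleftrightarrow> \<beta> = t - \<alpha> * t ^ 3" for \<alpha> \<beta> t :: 'a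
  unfolding plane_params_def mem_Collect_eq eq_diff_eq by (subst add.commute) (rule eq_commute)

lemma plane_params_zero: "plane_params 0 (\<beta> :: 'a) = {\<beta>}"
  by (auto simp: plane_params_def)

text \<open>The map t - \<alpha> t^3 is additive, and a nonzero kernel element r would satisfy
  \<alpha> r^2 = 1 and make \<alpha> a square. So the map is bijective.\<close>

lemma card_plane_params_nonsquare:
  fixes \<alpha> \<beta> :: 'a
  assumes "\<alpha> \<noteq> 0" "\<alpha> \<notin> nonzero_squares"
  shows "card (plane_params \<alpha> \<beta>) = 1"
proof -
  have inj: "inj (\<lambda>t. t - \<alpha> * t ^ 3)"
  proof (rule injI)
    fix s t
    assume "s - \<alpha> * s ^ 3 = t - \<alpha> * t ^ 3"
    then have "(s - t) - \<alpha> * (s - t) ^ 3 = 0" by (simp add: cube_diff algebra_simps)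
    moreover have "(s - t) - \<alpha> * (s - t) ^ 3 = (s - t) * (1 - \<alpha> * (s - t) ^ 2)" by algebra
    moreover have "1 - \<alpha> * r ^ 2 \<noteq> 0" for r
    proof
      assume "1 - \<alpha> * r ^ 2 = 0"
      then have r2: "\<alpha> * r ^ 2 = 1" unfolding right_minus_eq by (rule sym)
      have *: "r \<noteq> 0"
      proof
        assume "r = 0"
        then show False using r2 by simp
      qed
      have "\<alpha> = 1 / r ^ 2" using nonzero_eq_divide_eq[of "r ^ 2" \<alpha> 1] * r2 by simp
      then have "\<alpha> = (1 / r) ^ 2" by (simp only: power_divide power_one)
      then show False using assms(2) * by (auto simp: nonzero_squares_def)
    qed
    ultimately have "s - t = 0" by (simp only: mult_eq_0_iff) blast
    then show "s = t" by simp
  qed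
  then have "surj (\<lambda>t. t - \<alpha> * t ^ 3)" by (rule finite_UNIV_inj_surj[rotated]) simp
  then obtain t where t: "\<beta> = t - \<alpha> * t ^ 3" unfolding surj_def by blast
  have "plane_params \<alpha> \<beta> = {s. s - \<alpha> * s ^ 3 = t - \<alpha> * t ^ 3}"
    unfolding set_eq_iff mem_Collect_eq mem_plane_params_iff t by (intro allI) (rule eq_commute)
  also have "\<dots> = {t}" unfolding inj_eq[OF inj] by (rule singleton_conv)
  finally show ?thesis by simp
qed

text \<open>With \<alpha> = w^2 the kernel of t - \<alpha> t^3 is {0, 1 / w, - 1 / w}, and a
  nonempty solution set is a coset of it.\<close>

lemma card_plane_params_square:
  fixes \<alpha> \<beta> :: 'a
  assumes "\<alpha> \<in> nonzero_squares" "plane_params \<alpha> \<beta> \<noteq> {}"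
  shows "card (plane_params \<alpha> \<beta>) = 3"
proof -
  obtain w where w: "w \<noteq> 0" "\<alpha> = w ^ 2" using assms(1) by (auto simp: nonzero_squares_def)
  obtain t where t: "\<beta> = t - \<alpha> * t ^ 3" using assms(2) mem_plane_params_iff by blast
  have "s \<in> plane_params \<alpha> \<beta> \<longleftrightarrow> s \<in> {t, t + 1 / w, t - 1 / w}" for s
  proof -
    have *: "(s - t) - \<alpha> * (s - t) ^ 3 = (s - \<alpha> * s ^ 3) - (t - \<alpha> * t ^ 3)"
      by (simp add: cube_diff algebra_simps)
    have "s \<in> plane_params \<alpha> \<beta> \<longleftrightarrow> (s - t) - \<alpha> * (s - t) ^ 3 = 0"
      unfolding * right_minus_eq mem_plane_params_iff t by (rule eq_commute)
    also have "(s - t) - \<alpha> * (s - t) ^ 3 = (s - t) * (1 - w * (s - t)) * (1 + w * (s - t))"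
      unfolding w by algebra
    also have "1 - w * (s - t) = w * ((t + 1 / w) - s)" using w(1) by (simp add: algebra_simps)
    also have "1 + w * (s - t) = w * (s - (t - 1 / w))" using w(1) by (simp add: algebra_simps)
    finally have "s \<in> plane_params \<alpha> \<beta> \<longleftrightarrow> s - t = 0 \<or> (t + 1 / w) - s = 0 \<or> s - (t - 1 / w) = 0"
      using w(1) by (simp only: mult_eq_0_iff disj_assoc simp_thms)
    then show ?thesis unfolding right_minus_eq by blast
  qed
  then have "plane_params \<alpha> \<beta> = {t, t + 1 / w, t - 1 / w}" by blast
  moreover have "t + 1 / w \<noteq> t - 1 / w"
    using w(1) neg_eq_self_iff(2)[of "1 / w"] by (simp add: diff_conv_add_uminus del: add_uminus_conv_diff)
  ultimately show ?thesis using w(1) by simp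
qed

lemma plane_through_in_plane_class:
  fixes \<alpha> \<beta> :: 'a
  shows plane_class_2_iff: "plane_through \<alpha> \<beta> \<in> plane_class 2 \<longleftrightarrow> \<alpha> = 0"
    and plane_class_1_iff: "plane_through \<alpha> \<beta> \<in> plane_class 1 \<longleftrightarrow> \<alpha> \<noteq> 0 \<and> \<alpha> \<notin> nonzero_squares"
    and plane_class_3_iff:
      "plane_through \<alpha> \<beta> \<in> plane_class 3 \<longleftrightarrow> \<alpha> \<in> nonzero_squares \<and> plane_params \<alpha> \<beta> \<noteq> {}"
    and plane_class_0_iff:
      "plane_through \<alpha> \<beta> \<in> plane_class 0 \<longleftrightarrow> \<alpha> \<in> nonzero_squares \<and> plane_params \<alpha> \<beta> = {}"
proof -
  have class_iff: "plane_through \<alpha> \<beta> \<in> plane_class d \<longleftrightarrow>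
      card (plane_params \<alpha> \<beta>) + (if \<alpha> = 0 then 1 else 0) = d" for d and \<alpha> \<beta> :: 'a
    unfolding plane_through_in_plane_class_iff plane_params_def ..
  consider "\<alpha> = 0" | "\<alpha> \<noteq> 0" "\<alpha> \<notin> nonzero_squares" | "\<alpha> \<in> nonzero_squares" by blast
  then have "(plane_through \<alpha> \<beta> \<in> plane_class 2 \<longleftrightarrow> \<alpha> = 0) \<and>
    (plane_through \<alpha> \<beta> \<in> plane_class 1 \<longleftrightarrow> \<alpha> \<noteq> 0 \<and> \<alpha> \<notin> nonzero_squares) \<and>
    (plane_through \<alpha> \<beta> \<in> plane_class 3 \<longleftrightarrow> \<alpha> \<in> nonzero_squares \<and> plane_params \<alpha> \<beta> \<noteq> {}) \<and>
    (plane_through \<alpha> \<beta> \<in> plane_class 0 \<longleftrightarrow> \<alpha> \<in> nonzero_squares \<and> plane_params \<alpha> \<beta> = {})"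
  proof cases
    case 1
    then show ?thesis by (simp add: class_iff plane_params_zero)
  next
    case 2
    then show ?thesis by (auto simp: class_iff card_plane_params_nonsquare)
  next
    case 3
    then show ?thesis
      by (cases "plane_params \<alpha> \<beta> = {}") (auto simp: class_iff card_plane_params_square)
  qed
  then show "plane_through \<alpha> \<beta> \<in> plane_class 2 \<longleftrightarrow> \<alpha> = 0"
    "plane_through \<alpha> \<beta> \<in> plane_class 1 \<longleftrightarrow> \<alpha> \<noteq> 0 \<and> \<alpha> \<notin> nonzero_squares"
    "plane_through \<alpha> \<beta> \<in> plane_class 3 \<longleftrightarrow> \<alpha> \<in> nonzero_squares \<and> plane_params \<alpha> \<beta> \<noteq> {}"
    "plane_through \<alpha> \<beta> \<in> plane_class 0 \<longleftrightarrow> \<alpha> \<in> nonzero_squares \<and> plane_params \<alpha> \<beta> = {}"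
    by blast+
qed

lemma plane_params_one: "plane_params 1 (\<beta> :: 'a) \<noteq> {} \<longleftrightarrow> \<beta> \<in> artin_schreier_image"
proof -
  have "plane_params 1 \<beta> \<noteq> {} \<longleftrightarrow> (\<exists>t. \<beta> = t - t ^ 3)"
    by (auto simp: mem_plane_params_iff set_eq_iff)
  then show ?thesis by (auto simp: artin_schreier_image_def)
qed

text \<open>The substitution u = - w t turns t = w^2 t^3 - w^2 into u - u^3 = w^3. The value \<beta>
  = - \<alpha> is the one that occurs for the planes on \<open>line_through 1 0\<close>.\<close>

lemma plane_params_opposite:
  fixes w :: 'a
  assumes "w \<noteq> 0"
  shows "plane_params (w ^ 2) (- (w ^ 2)) \<noteq> {} \<longleftrightarrow> w ^ 3 \<in> artin_schreier_image"
proof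
  assume "plane_params (w ^ 2) (- (w ^ 2)) \<noteq> {}"
  then obtain t where t: "t = w ^ 2 * t ^ 3 - w ^ 2" by (auto simp: plane_params_def)
  have "w ^ 3 = - (w * t) - (- (w * t)) ^ 3 + w * (t - (w ^ 2 * t ^ 3 - w ^ 2))" by algebra
  then have "w ^ 3 = - (w * t) - (- (w * t)) ^ 3" using t by simp
  then show "w ^ 3 \<in> artin_schreier_image" unfolding artin_schreier_image_def by (rule range_eqI)
next
  assume "w ^ 3 \<in> artin_schreier_image"
  then obtain u where u: "w ^ 3 = u - u ^ 3" by (auto simp: artin_schreier_image_def)
  define t where "t = - u / w"
  have ut: "u = - (w * t)" using assms by (simp add: t_def)
  have "w * (t - (w ^ 2 * t ^ 3 - w ^ 2)) = w ^ 3 - (u - u ^ 3)" unfolding ut by algebra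
  then have "t - (w ^ 2 * t ^ 3 - w ^ 2) = 0" using u assms by simp
  then have "t = w ^ 2 * t ^ 3 + - (w ^ 2)" by simp
  then show "plane_params (w ^ 2) (- (w ^ 2)) \<noteq> {}" unfolding plane_params_def by blast
qed

text \<open>Squaring maps \<open>?W\<close> two-to-one onto the set in question, and cubing maps
  \<open>?W\<close> bijectively onto the nonzero elements of the Artin-Schreier image.\<close>

lemma card_solvable_opposite:
  "2 * card {\<alpha> :: 'a. \<alpha> \<in> nonzero_squares \<and> plane_params \<alpha> (- \<alpha>) \<noteq> {}} =
    card (artin_schreier_image :: 'a set) - 1"
proof -
  let ?W = "{w :: 'a. w \<noteq> 0 \<and> w ^ 3 \<in> artin_schreier_image}"
  \<comment> \<open>This puts \<open>- w\<close> into \<open>?W\<close> along with \<open>w\<close>,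
    so that every fibre of squaring has two elements.\<close>
  have minus: "- h \<in> artin_schreier_image" if h: "h \<in> artin_schreier_image" for h :: 'a
  proof -
    obtain t where t: "h = t - t ^ 3" using h by (auto simp: artin_schreier_image_def)
    have "- h = - t - (- t) ^ 3" unfolding t by algebra
    then show ?thesis unfolding artin_schreier_image_def by (rule range_eqI)
  qed
  have "card ?W = 2 * card ((\<lambda>w. w ^ 2) ` ?W)"
  proof (rule card_eq_fibre_card_mult)
    fix w assume w: "w \<in> ?W"
    then have "{y \<in> ?W. y ^ 2 = w ^ 2} = {y \<in> UNIV - {0}. y ^ 2 = w ^ 2}"
      by (auto simp: power2_eq_iff cube_minus minus)
    then show "card {y \<in> ?W. y ^ 2 = w ^ 2} = 2" using w card_square_fibre by simp
  qed simp
  also have "(\<lambda>w. w ^ 2) ` ?W = {\<alpha>. \<alpha> \<in> nonzero_squares \<and> plane_params \<alpha> (- \<alpha>) \<noteq> {}}"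
  proof (intro set_eqI iffI)
    fix \<alpha> assume "\<alpha> \<in> (\<lambda>w. w ^ 2) ` ?W"
    then show "\<alpha> \<in> {\<alpha>. \<alpha> \<in> nonzero_squares \<and> plane_params \<alpha> (- \<alpha>) \<noteq> {}}"
      using plane_params_opposite by (auto simp: nonzero_squares_def)
  next
    fix \<alpha> assume "\<alpha> \<in> {\<alpha> :: 'a. \<alpha> \<in> nonzero_squares \<and> plane_params \<alpha> (- \<alpha>) \<noteq> {}}"
    then show "\<alpha> \<in> (\<lambda>w. w ^ 2) ` ?W"
      using plane_params_opposite by (auto simp: nonzero_squares_def)
  qed
  also have "card ?W = card ((\<lambda>w. w ^ 3) ` ?W)"
    by (rule card_image[symmetric]) (simp add: inj_on_def cube_eq_iff)
  also have "(\<lambda>w. w ^ 3) ` ?W = artin_schreier_image - {0}"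
  proof (intro set_eqI iffI)
    fix x :: 'a
    assume x: "x \<in> artin_schreier_image - {0}"
    obtain w where w: "w ^ 3 = x" using surj_cube by blast
    then have "w \<in> ?W" using x by auto
    then show "x \<in> (\<lambda>w. w ^ 3) ` ?W" using w by blast
  qed auto
  finally have "card (artin_schreier_image - {0 :: 'a}) =
    2 * card {\<alpha> :: 'a. \<alpha> \<in> nonzero_squares \<and> plane_params \<alpha> (- \<alpha>) \<noteq> {}}" .
  moreover have "(0 :: 'a) \<in> artin_schreier_image"
    unfolding artin_schreier_image_def by (rule range_eqI[of _ _ 0]) simp
  ultimately show ?thesis by (simp add: card_Diff_singleton)
qed

end

text \<open>The classes are defined by incidences with planes only, which makes their invariance immediate.\<close>

definition EA1 :: "('a::field ^ 4) set set" where
  "EA1 = {L \<in> EA_lines. \<exists>S \<in> plane_class 2. L \<subseteq> S}"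

definition EA2 :: "('a::field ^ 4) set set" where
  "EA2 = {L \<in> EA_lines. L \<notin> EA1 \<and> (\<exists>S \<in> plane_class 3. L \<subseteq> S)}"

definition EA3 :: "('a::field ^ 4) set set" where
  "EA3 = EA_lines - EA1 - EA2"

section \<open>Invariant classes and the planes on the representative lines\<close>

definition invariant_class :: "('a::field ^ 4) set set \<Rightarrow> bool" where
  "invariant_class K \<longleftrightarrow> (\<forall>A \<in> cubic_matrices. \<forall>S \<in> K. act A S \<in> K)"

lemma invariant_class_iff:
  assumes "invariant_class K" "A \<in> cubic_matrices"
  shows "act A S \<in> K \<longleftrightarrow> S \<in> K"
proof
  assume S: "act A S \<in> K"
  obtain B where B: "B \<in> cubic_matrices" "B ** A = mat 1" using cubic_matrices_inverse[OF assms(2)] .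
  then have "act B (act A S) \<in> K" using assms(1) S unfolding invariant_class_def by blast
  then show "S \<in> K" by (simp add: act_act B)
qed (use assms in \<open>simp add: invariant_class_def\<close>)

lemma card_invariant_class:
  fixes K :: "('a::{field,finite} ^ 4) set set"
  assumes "invariant_class K" "A \<in> cubic_matrices" "\<And>S. P S \<longleftrightarrow> P' (act A S)"
  shows "card {S \<in> K. P S} = card {S \<in> K. P' S}"
  by (rule card_transport[where P = P and P' = P', OF assms(2) _ assms(3)])
    (use assms(1) in \<open>simp add: invariant_class_def\<close>)

context char_3_field
begin

lemma invariant_plane_class: "invariant_class (plane_class d :: ('a ^ 4) set set)"
  by (simp add: invariant_class_def plane_class_act)

lemma in_some_plane_act:
  fixes A :: "'a ^ 4 ^ 4"
  assumes A: "A \<in> cubic_matrices"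
  shows "(\<exists>S \<in> plane_class d. L \<subseteq> S) \<longrightarrow> (\<exists>S \<in> plane_class d. act A L \<subseteq> S)"
proof
  assume "\<exists>S \<in> plane_class d. L \<subseteq> S"
  then obtain S where "S \<in> plane_class d" "L \<subseteq> S" by (rule bexE)
  then show "\<exists>S \<in> plane_class d. act A L \<subseteq> S"
    using plane_class_act[OF A] by (intro bexI[of _ "act A S"] act_mono)
qed

lemma invariant_EA1: "invariant_class (EA1 :: ('a ^ 4) set set)"
  unfolding invariant_class_def
proof (intro ballI)
  fix A :: "'a ^ 4 ^ 4" and L :: "('a ^ 4) set"
  assume "A \<in> cubic_matrices" "L \<in> EA1"
  then show "act A L \<in> EA1"
    using EA_lines_act[of A L] in_some_plane_act[of A 2 L] by (simp add: EA1_def)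
qed

lemma invariant_EA2: "invariant_class (EA2 :: ('a ^ 4) set set)"
  unfolding invariant_class_def
proof (intro ballI)
  fix A :: "'a ^ 4 ^ 4" and L :: "('a ^ 4) set"
  assume "A \<in> cubic_matrices" "L \<in> EA2"
  then show "act A L \<in> EA2"
    using EA_lines_act[of A L] in_some_plane_act[of A 3 L] invariant_class_iff[OF invariant_EA1, of A L]
    by (simp add: EA2_def)
qed

lemma invariant_EA3: "invariant_class (EA3 :: ('a ^ 4) set set)"
  unfolding invariant_class_def
proof (intro ballI)
  fix A :: "'a ^ 4 ^ 4" and L :: "('a ^ 4) set"
  assume "A \<in> cubic_matrices" "L \<in> EA3"
  then show "act A L \<in> EA3"
    using EA_lines_act[of A L] invariant_class_iff[OF invariant_EA1, of A L]
      invariant_class_iff[OF invariant_EA2, of A L]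
    by (auto simp: EA3_def)
qed

lemma plane_class_planes:
  fixes L :: "('a ^ 4) set"
  assumes "axis_point \<in> L"
  shows "{S \<in> plane_class d. L \<subseteq> S} =
    case_prod plane_through ` {(\<alpha>, \<beta>). plane_through \<alpha> \<beta> \<in> plane_class d \<and> L \<subseteq> plane_through \<alpha> \<beta>}"
proof (intro equalityI subsetI)
  fix S assume S: "S \<in> {S \<in> plane_class d. L \<subseteq> S}"
  then obtain \<alpha> \<beta> where "S = plane_through \<alpha> \<beta>"
    using assms plane_through_axis_point[of S] by (auto simp: plane_class_def)
  then show "S \<in> case_prod plane_through ` {(\<alpha>, \<beta>). plane_through \<alpha> \<beta> \<in> plane_class d \<and> L \<subseteq> plane_through \<alpha> \<beta>}"
    using S by force
qed auto

lemma card_planes_on_line: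
  fixes L :: "('a ^ 4) set"
  assumes "axis_point \<in> L"
  shows "card {S \<in> plane_class d. L \<subseteq> S} =
    card {(\<alpha>, \<beta>). plane_through \<alpha> \<beta> \<in> plane_class d \<and> L \<subseteq> plane_through \<alpha> \<beta>}"
  unfolding plane_class_planes[OF assms] by (rule card_image) (auto simp: inj_on_def)

text \<open>The incidence condition v = \<alpha> u + \<beta> at u = 1, v = 0 reads \<beta> = -
  \<alpha>, so \<alpha> alone parametrises the planes.\<close>

lemma card_planes_on_line_through:
  "card {S \<in> plane_class d. line_through 1 (0 :: 'a) \<subseteq> S} =
    card {\<alpha> :: 'a. plane_through \<alpha> (- \<alpha>) \<in> plane_class d}"
proof -
  have "line_through 1 (0 :: 'a) \<subseteq> plane_through \<alpha> \<beta> \<longleftrightarrow> \<beta> = - \<alpha>" for \<alpha> \<beta>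
    unfolding line_through_subset_iff mult_1_right add_eq_0_iff[symmetric] by (rule eq_commute)
  then have "{(\<alpha>, \<beta>). plane_through \<alpha> \<beta> \<in> plane_class d \<and> line_through 1 (0 :: 'a) \<subseteq> plane_through \<alpha> \<beta>}
    = (\<lambda>\<alpha>. (\<alpha>, - \<alpha>)) ` {\<alpha> :: 'a. plane_through \<alpha> (- \<alpha>) \<in> plane_class d}"
    by auto
  then show ?thesis
    by (simp add: card_planes_on_line card_image inj_on_def)
qed

text \<open>Incidence fixes \<alpha> = v and leaves \<beta> free.\<close>

lemma card_planes_on_line_at_inf:
  "card {S \<in> plane_class d. line_at_inf (v :: 'a) \<subseteq> S} =
    card {\<beta> :: 'a. plane_through v \<beta> \<in> plane_class d}"
proof -
  have "{(\<alpha>, \<beta>). plane_through \<alpha> \<beta> \<in> plane_class d \<and> line_at_inf (v :: 'a) \<subseteq> plane_through \<alpha> \<beta>}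
    = Pair v ` {\<beta> :: 'a. plane_through v \<beta> \<in> plane_class d}"
    by (auto simp: line_at_inf_subset_iff)
  then show ?thesis
    by (simp add: card_planes_on_line card_image inj_on_def)
qed

subsection \<open>The three classes of EA-lines\<close>

text \<open>\<open>plane_through 0 v\<close> always contains the line and has two cubic points, so
  all EA-lines of this form belong to the first class.\<close>

lemma line_through_in_EA1_iff: "line_through u (v :: 'a) \<in> EA1 \<longleftrightarrow> u \<noteq> v ^ 3"
proof -
  have "plane_through 0 v \<in> plane_class 2" by (simp add: plane_class_2_iff)
  moreover have "line_through u v \<subseteq> plane_through 0 v" by (simp add: line_through_subset_iff)
  ultimately have "\<exists>S \<in> plane_class 2. line_through u v \<subseteq> S" by blast
  then show ?thesis by (simp add: EA1_def line_through_in_EA_iff)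
qed

lemma line_at_inf_in_some_plane_iff:
  "(\<exists>S \<in> plane_class d. line_at_inf (v :: 'a) \<subseteq> S) \<longleftrightarrow> (\<exists>\<beta>. plane_through v \<beta> \<in> plane_class d)"
proof -
  have "(\<exists>S \<in> plane_class d. line_at_inf v \<subseteq> S) \<longleftrightarrow> {S \<in> plane_class d. line_at_inf v \<subseteq> S} \<noteq> {}"
    by blast
  then show ?thesis
    unfolding plane_class_planes[OF axis_point_mem(2)] by (auto simp: line_at_inf_subset_iff)
qed

text \<open>A plane of class 2 on this line would need \<alpha> = v = 0, but then the line contains
  a cubic point.\<close>

lemma line_at_inf_notin_EA1: "line_at_inf (v :: 'a) \<notin> EA1"
proof
  assume "line_at_inf v \<in> EA1"
  then have "v \<noteq> 0" "\<exists>\<beta>. plane_through v \<beta> \<in> plane_class 2"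
    by (simp_all add: EA1_def line_at_inf_in_EA_iff line_at_inf_in_some_plane_iff)
  then show False by (simp add: plane_class_2_iff)
qed

lemma plane_params_nonempty: "\<exists>\<beta>. plane_params \<alpha> \<beta> \<noteq> {}" for \<alpha> :: 'a
  using mem_plane_params_iff by blast

lemma line_at_inf_in_EA2_iff: "line_at_inf (v :: 'a) \<in> EA2 \<longleftrightarrow> v \<in> nonzero_squares"
  using plane_params_nonempty
  by (auto simp: EA2_def line_at_inf_in_EA_iff line_at_inf_notin_EA1 line_at_inf_in_some_plane_iff
      plane_class_3_iff)

lemma line_at_inf_in_EA3_iff: "line_at_inf (v :: 'a) \<in> EA3 \<longleftrightarrow> v \<noteq> 0 \<and> v \<notin> nonzero_squares"
  by (simp add: EA3_def line_at_inf_in_EA_iff line_at_inf_notin_EA1 line_at_inf_in_EA2_iff)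

lemma line_through_notin_EA2_EA3: "line_through u (v :: 'a) \<notin> EA2" "line_through u (v :: 'a) \<notin> EA3"
  using line_through_in_EA1_iff line_through_in_EA_iff by (auto simp: EA2_def EA3_def)

lemma EA_line_move:
  fixes L :: "('a ^ 4) set"
  assumes "L \<in> EA_lines"
  obtains A u v where "A \<in> cubic_matrices" "act A L = line_through u v"
    | A v where "A \<in> cubic_matrices" "act A L = line_at_inf v"
proof -
  obtain x where "x \<in> axis" "x \<noteq> 0" "x \<in> L" "vec.subspace L"
    using assms by (auto simp: line_in_EA_iff pg_lines_def)
  then obtain A where A: "A \<in> cubic_matrices" "axis_point \<in> act A L"
    by (rule move_subspace_to_axis_point)
  have "act A L \<in> EA_lines" using EA_lines_act[OF A(1) assms] .
  then show thesis
    using that A line_through_axis_point_cases[of "act A L"] by (metis line_in_EA_iff)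
qed

lemma EA1_move:
  assumes "L \<in> EA1"
  obtains A where "A \<in> cubic_matrices" "act A L = line_through 1 (0 :: 'a)"
proof -
  have "L \<in> EA_lines" using assms by (simp add: EA1_def)
  then show thesis
  proof (cases rule: EA_line_move)
    case (1 A u v)
    then have "line_through u v \<in> EA1" using assms invariant_class_iff[OF invariant_EA1 1(1)] by metis
    then have uv: "u - v ^ 3 \<noteq> 0" by (simp add: line_through_in_EA1_iff)
    \<comment> \<open>The shift by \<open>- v\<close> sends (u, v) to (u - v^3, 0), and the scaling
      by \<open>a\<close> multiplies the first entry by a^3.\<close>
    obtain a where a: "a ^ 3 = 1 / (u - v ^ 3)" using surj_cube by blast
    then have a0: "a \<noteq> 0" using uv by auto
    let ?B = "scale_matrix a ** shift_matrix (- v)"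
    have B: "?B \<in> cubic_matrices"
      by (intro cubic_matrices_mult scale_matrix_in_cubic_matrices shift_matrix_in_cubic_matrices a0)
    have "act ?B (line_through u v) = line_through 1 0"
    proof (rule act_eqI[OF cubic_matricesD[OF B]])
      fix x assume "x \<in> line_through u v"
      then show "?B *v x \<in> line_through 1 0"
        using a uv by (simp add: line_through_def matrix_vector_mul_assoc[symmetric] scale_matrix_nth
          shift_matrix_nth cube_minus left_diff_distrib[symmetric])
    qed (simp_all add: pg_linesD line_through_in_pg_lines)
    then have "act (?B ** A) L = line_through 1 0" by (simp only: act_act[symmetric, of ?B A] 1(2))
    then show thesis by (rule that[OF cubic_matrices_mult[OF B 1(1)]])
  next
    case (2 A v)
    then have "line_at_inf v \<in> EA1" using assms invariant_class_iff[OF invariant_EA1 2(1)] by metis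
    then show thesis by (simp add: line_at_inf_notin_EA1)
  qed
qed

text \<open>Scaling multiplies x2 by s and x0 by s^3, so the parameter of the line matters only up
  to nonzero squares.\<close>

lemma act_scale_line_at_inf:
  fixes s v :: 'a
  assumes "s \<noteq> 0"
  shows "act (scale_matrix s) (line_at_inf (v * s ^ 2)) = line_at_inf v"
proof (rule act_eqI)
  fix x assume "x \<in> line_at_inf (v * s ^ 2)"
  then show "scale_matrix s *v x \<in> line_at_inf v"
    by (simp add: line_at_inf_def scale_matrix_nth power2_eq_square power3_eq_cube)
qed (use assms in \<open>simp_all add: pg_linesD line_at_inf_in_pg_lines cubic_matricesD
  scale_matrix_in_cubic_matrices\<close>)

lemma EA23_move:
  assumes "L \<in> EA2 \<or> L \<in> EA3"
  obtains A and v :: 'a where "A \<in> cubic_matrices" "act A L = line_at_inf v"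
proof -
  have "L \<in> EA_lines" using assms by (auto simp: EA2_def EA3_def)
  then show thesis
  proof (cases rule: EA_line_move)
    case (1 A u v)
    then have "line_through u v \<in> EA2 \<or> line_through u v \<in> EA3"
      using assms invariant_class_iff[OF invariant_EA2 1(1)] invariant_class_iff[OF invariant_EA3 1(1)] by metis
    then show thesis by (simp add: line_through_notin_EA2_EA3)
  qed (use that in blast)
qed

lemma EA2_move:
  assumes "L \<in> EA2"
  obtains A where "A \<in> cubic_matrices" "act A L = line_at_inf (1 :: 'a)"
proof -
  obtain A v where A: "A \<in> cubic_matrices" "act A L = line_at_inf v" using assms EA23_move by metis
  then have "v \<in> nonzero_squares"
    using assms invariant_class_iff[OF invariant_EA2 A(1)] line_at_inf_in_EA2_iff by metis
  then obtain s where s: "s \<noteq> 0" "v = 1 * s ^ 2" by (auto simp: nonzero_squares_def)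
  show thesis
    using that[of "scale_matrix s ** A"] A s act_scale_line_at_inf[OF s(1), of 1]
    by (simp add: act_act[symmetric] cubic_matrices_mult scale_matrix_in_cubic_matrices)
qed

lemma EA3_move:
  fixes \<rho> :: 'a
  assumes "L \<in> EA3" and \<rho>: "\<rho> \<noteq> 0" "\<rho> \<notin> nonzero_squares"
  obtains A where "A \<in> cubic_matrices" "act A L = line_at_inf \<rho>"
proof -
  obtain A v where A: "A \<in> cubic_matrices" "act A L = line_at_inf v" using assms EA23_move by metis
  then have "v \<noteq> 0" "v \<notin> nonzero_squares"
    using assms(1) invariant_class_iff[OF invariant_EA3 A(1)] line_at_inf_in_EA3_iff by metis+
  then obtain s where s: "s \<noteq> 0" "v = \<rho> * s ^ 2" using nonsquare_ratio \<rho> by metis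
  show thesis
    using that[of "scale_matrix s ** A"] A s act_scale_line_at_inf[OF s(1), of \<rho>]
    by (simp add: act_act[symmetric] cubic_matrices_mult scale_matrix_in_cubic_matrices)
qed

lemma ex_nonsquare: "\<exists>\<rho> :: 'a. \<rho> \<noteq> 0 \<and> \<rho> \<notin> nonzero_squares"
proof (rule ccontr)
  assume "\<not> ?thesis"
  then have empty: "{x :: 'a. x \<noteq> 0 \<and> x \<notin> nonzero_squares} = {}" by blast
  show False using card_nonsquares card_ge unfolding empty by simp
qed

lemma EA_classes_subset:
  "EA1 \<subseteq> (EA_lines :: ('a ^ 4) set set)" "EA2 \<subseteq> (EA_lines :: ('a ^ 4) set set)"
  "EA3 \<subseteq> (EA_lines :: ('a ^ 4) set set)"
  by (auto simp: EA1_def EA2_def EA3_def)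

text \<open>Any two lines of \<open>K\<close> can be moved to the common line \<open>R\<close>,
  hence to each other; invariance keeps the orbit inside \<open>K\<close>.\<close>

lemma cubic_orbit_eq_class:
  fixes R :: "('a ^ 4) set"
  assumes inv: "invariant_class K" and K: "K \<subseteq> EA_lines"
    and move: "\<And>L. L \<in> K \<Longrightarrow> \<exists>A \<in> cubic_matrices. act A L = R"
    and L: "L \<in> K"
  shows "cubic_orbit L = K"
proof -
  have "vec.subspace L" using L K by (auto simp: line_in_EA_iff pg_lines_def)
  then have orbit: "cubic_orbit L = (\<lambda>A. act A L) ` cubic_matrices" by (rule cubic_orbit_eq)
  have "L' \<in> cubic_orbit L" if L': "L' \<in> K" for L'
  proof -
    obtain A where A: "A \<in> cubic_matrices" "act A L = R" using move[OF L] by blast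
    obtain B where B: "B \<in> cubic_matrices" "act B L' = R" using move[OF L'] by blast
    obtain C where C: "C \<in> cubic_matrices" "C ** B = mat 1" using cubic_matrices_inverse[OF B(1)] .
    have "act (C ** A) L = act C (act B L')" by (simp only: act_act[symmetric] A B)
    also have "\<dots> = L'" by (simp add: act_act C)
    finally have "act (C ** A) L = L'" .
    then show ?thesis unfolding orbit using cubic_matrices_mult[OF C(1) A(1)] by blast
  qed
  moreover have "cubic_orbit L \<subseteq> K" unfolding orbit using inv L by (auto simp: invariant_class_def)
  ultimately show ?thesis by blast
qed

lemma cubic_orbit_image_eq:
  fixes R :: "('a ^ 4) set"
  assumes inv: "invariant_class K" and K: "K \<subseteq> EA_lines" and R: "R \<in> K"
    and move: "\<And>L. L \<in> K \<Longrightarrow> \<exists>A \<in> cubic_matrices. act A L = R"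
  shows "cubic_orbit ` K = {K}"
proof -
  have "cubic_orbit L = K" if "L \<in> K" for L
    using inv K move that by (rule cubic_orbit_eq_class)
  then have "cubic_orbit ` K = (\<lambda>_. K) ` K" by (rule image_cong[OF refl])
  also have "\<dots> = {K}" using R by (rule image_constant)
  finally show ?thesis .
qed

lemma EA_orbits_eq: "(EA_orbits :: ('a ^ 4) set set set) = {EA1, EA2, EA3}"
  and EA_classes_distinct: "distinct [EA1, EA2, EA3 :: ('a ^ 4) set set]"
proof -
  obtain \<rho> :: 'a where \<rho>: "\<rho> \<noteq> 0" "\<rho> \<notin> nonzero_squares" using ex_nonsquare by blast
  have one: "(1 :: 'a) \<in> nonzero_squares"
    unfolding nonzero_squares_def by (rule image_eqI[of _ _ 1]) simp_all
  have R1: "line_through 1 (0 :: 'a) \<in> EA1" by (simp add: line_through_in_EA1_iff)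
  have R2: "line_at_inf (1 :: 'a) \<in> EA2" by (simp add: line_at_inf_in_EA2_iff one)
  have R3: "line_at_inf \<rho> \<in> EA3" using \<rho> by (simp add: line_at_inf_in_EA3_iff)
  have "EA1 \<noteq> (EA2 :: ('a ^ 4) set set)" using R2 line_at_inf_notin_EA1 by metis
  moreover have "EA1 \<noteq> (EA3 :: ('a ^ 4) set set)" using R3 line_at_inf_notin_EA1 by metis
  moreover have "EA2 \<noteq> (EA3 :: ('a ^ 4) set set)" using R2 one line_at_inf_in_EA3_iff by metis
  ultimately show "distinct [EA1, EA2, EA3 :: ('a ^ 4) set set]" by simp
  have un: "EA_lines = (EA1 \<union> EA2 \<union> EA3 :: ('a ^ 4) set set)"
    using EA_classes_subset by (auto simp: EA3_def)
  have "cubic_orbit ` EA1 = {EA1 :: ('a ^ 4) set set}"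
    by (rule cubic_orbit_image_eq[OF invariant_EA1 EA_classes_subset(1) R1])
      (erule EA1_move, rule bexI)
  moreover have "cubic_orbit ` EA2 = {EA2 :: ('a ^ 4) set set}"
    by (rule cubic_orbit_image_eq[OF invariant_EA2 EA_classes_subset(2) R2])
      (erule EA2_move, rule bexI)
  moreover have "cubic_orbit ` EA3 = {EA3 :: ('a ^ 4) set set}"
    by (rule cubic_orbit_image_eq[OF invariant_EA3 EA_classes_subset(3) R3])
      (erule EA3_move[OF _ \<rho>], rule bexI)
  ultimately show "(EA_orbits :: ('a ^ 4) set set set) = {EA1, EA2, EA3}"
    unfolding EA_orbits_def un image_Un by (simp add: insert_commute)
qed

subsection \<open>Sizes of the orbits\<close>

text \<open>One normalised vector for each of the q + 1 points of the axis.\<close>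

definition axis_reps :: "('a ^ 4) set" where
  "axis_reps = insert axis_point (range (\<lambda>u. vector [0, u, 1, 0]))"

lemma axis_reps_sub: "r \<in> axis_reps \<Longrightarrow> r \<in> axis \<and> r \<noteq> 0"
  by (auto simp: axis_reps_def axis_eq vec4_eq_iff)

lemma card_axis_reps: "card axis_reps = CARD('a) + 1"
proof -
  have "card (range (\<lambda>u::'a. vector [0, u, 1, 0] :: 'a ^ 4)) = CARD('a)"
    by (rule card_image) (auto simp: inj_on_def vec4_eq_iff)
  moreover have "axis_point \<notin> range (\<lambda>u::'a. vector [0, u, 1, 0] :: 'a ^ 4)"
    by (auto simp: vec4_eq_iff)
  ultimately show ?thesis by (simp add: axis_reps_def)
qed

lemma ex_axis_rep:
  assumes x: "x \<in> axis" "x \<noteq> 0"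
  shows "\<exists>r \<in> axis_reps. \<exists>k. r = k *s x"
proof (cases "x $ 3 = 0")
  case True
  then have "axis_point = (1 / x $ 2) *s x"
    using x by (auto simp: axis_eq vec4_eq_iff)
  then show ?thesis by (auto simp: axis_reps_def)
next
  case False
  then have "vector [0, x $ 2 / x $ 3, 1, 0] = (1 / x $ 3) *s x"
    using x by (auto simp: axis_eq vec4_eq_iff)
  then show ?thesis by (auto simp: axis_reps_def)
qed

lemma two_axis_reps_imp_axis:
  assumes L: "L \<in> pg_lines" "r \<in> L" "s \<in> L" and rs: "r \<in> axis_reps" "s \<in> axis_reps" "r \<noteq> s"
  shows "L = axis"
proof -
  have "s \<noteq> 0" using axis_reps_sub rs by blast
  moreover have "r \<notin> vec.span {s}"
    using rs by (auto simp: axis_reps_def vec.span_singleton vec4_eq_iff)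
  ultimately have span: "vec.span {r, s} \<in> pg_lines" by (rule pair_span_in_pg_lines)
  have "vec.span {r, s} \<subseteq> L" using L by (intro vec.span_minimal) (auto simp: pg_lines_def)
  moreover have "vec.span {r, s} \<subseteq> axis"
    using rs axis_reps_sub subspace_axis by (intro vec.span_minimal) auto
  ultimately show ?thesis
    using pg_lines_eqI[OF span] L(1) axis_in_pg_lines by metis
qed

text \<open>Each EA-line meets the axis in exactly one point, and the group is transitive on these q
  + 1 points, so every one of them carries as many lines of \<open>K\<close> as
  \<open>axis_point\<close>.\<close>

lemma card_EA_class:
  fixes K :: "('a ^ 4) set set"
  assumes inv: "invariant_class K" and K: "K \<subseteq> EA_lines"
  shows "card K = (CARD('a) + 1) * card {L \<in> K. axis_point \<in> L}"
proof -
  have "K = (\<Union>r\<in>axis_reps. {L \<in> K. r \<in> L})"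
  proof -
    have "\<exists>r \<in> axis_reps. r \<in> L" if L: "L \<in> K" for L
    proof -
      have "L \<in> EA_lines" using L K by (rule subsetD[rotated])
      then obtain x where x: "x \<in> axis" "x \<noteq> 0" "x \<in> L" "vec.subspace L"
        by (auto simp: line_in_EA_iff pg_lines_def)
      obtain r k where r: "r \<in> axis_reps" "r = k *s x" using ex_axis_rep[OF x(1,2)] by blast
      have "r \<in> L" unfolding r(2) using x(3,4) vec.subspace_scale by blast
      then show ?thesis using r(1) by blast
    qed
    then show ?thesis by blast
  qed
  also have "card \<dots> = (\<Sum>r\<in>axis_reps. card {L \<in> K. r \<in> L})"
  proof (rule card_UN_disjoint)
    show "\<forall>r\<in>axis_reps. \<forall>s\<in>axis_reps. r \<noteq> s \<longrightarrow> {L \<in> K. r \<in> L} \<inter> {L \<in> K. s \<in> L} = {}"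
    proof (intro ballI impI)
      fix r s assume rs: "r \<in> axis_reps" "s \<in> axis_reps" "r \<noteq> s"
      have False if "L \<in> K" "r \<in> L" "s \<in> L" for L
      proof -
        have "L \<in> EA_lines" using that(1) K by (rule subsetD[rotated])
        then show False using two_axis_reps_imp_axis[OF _ that(2,3) rs] by (simp add: line_in_EA_iff)
      qed
      then show "{L \<in> K. r \<in> L} \<inter> {L \<in> K. s \<in> L} = {}" by blast
    qed
  qed simp_all
  also have "\<dots> = (\<Sum>r\<in>axis_reps. card {L \<in> K. axis_point \<in> L})"
  proof (rule sum.cong)
    fix r assume r: "r \<in> axis_reps"
    obtain A k where A: "A \<in> cubic_matrices" "k \<noteq> 0" "A *v r = k *s axis_point"
      using move_to_axis_point axis_reps_sub[OF r] by metis
    \<comment> \<open>\<open>r\<close> is moved to \<open>axis_point\<close> only up to the factor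
      \<open>k\<close>, which subspaces absorb.\<close>
    have "{L \<in> K. axis_point \<in> L} = {L \<in> K. k *s axis_point \<in> L}"
    proof -
      have "axis_point \<in> L \<longleftrightarrow> k *s axis_point \<in> L" if "L \<in> K" for L
      proof -
        have "L \<in> EA_lines" using that K by (rule subsetD[rotated])
        then have sub: "vec.subspace L" by (simp add: line_in_EA_iff pg_lines_def)
        have "(1 / k) *s (k *s axis_point) = axis_point" using A(2) by simp
        then show ?thesis using vec.subspace_scale[OF sub] by metis
      qed
      then show ?thesis by blast
    qed
    moreover have "card {L \<in> K. r \<in> L} = card {L \<in> K. k *s axis_point \<in> L}"
      by (rule card_invariant_class[OF inv A(1)])
        (use act_mem_iff[OF cubic_matricesD[OF A(1)], of r] A(3) in simp)
    ultimately show "card {L \<in> K. r \<in> L} = card {L \<in> K. axis_point \<in> L}" by simp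
  qed simp
  finally show ?thesis by (simp add: card_axis_reps)
qed

lemma EA_line_through_axis_point_cases:
  fixes L :: "('a ^ 4) set"
  assumes "L \<in> EA_lines" "axis_point \<in> L"
  obtains u v where "L = line_through u v" | v where "L = line_at_inf v"
  using assms line_through_axis_point_cases[of L] by (auto simp: line_in_EA_iff)

lemma EA1_through_axis_point:
  "{L \<in> EA1. axis_point \<in> L} = case_prod line_through ` {(u, v :: 'a). u \<noteq> v ^ 3}"
proof (intro equalityI subsetI)
  fix L :: "('a ^ 4) set" assume L: "L \<in> {L \<in> EA1. axis_point \<in> L}"
  then have "L \<in> EA_lines" "axis_point \<in> L" by (auto simp: EA1_def)
  then show "L \<in> case_prod line_through ` {(u, v). u \<noteq> v ^ 3}"
    by (cases rule: EA_line_through_axis_point_cases)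
       (use L in \<open>auto simp: line_through_in_EA1_iff line_at_inf_notin_EA1\<close>)
qed (auto simp: line_through_in_EA1_iff)

lemma EA2_through_axis_point: "{L \<in> EA2. axis_point \<in> L} = line_at_inf ` (nonzero_squares :: 'a set)"
proof (intro equalityI subsetI)
  fix L :: "('a ^ 4) set" assume L: "L \<in> {L \<in> EA2. axis_point \<in> L}"
  then have "L \<in> EA_lines" "axis_point \<in> L" by (auto simp: EA2_def)
  then show "L \<in> line_at_inf ` nonzero_squares"
    by (cases rule: EA_line_through_axis_point_cases)
       (use L in \<open>auto simp: line_at_inf_in_EA2_iff line_through_notin_EA2_EA3\<close>)
qed (auto simp: line_at_inf_in_EA2_iff)

lemma EA3_through_axis_point:
  "{L \<in> EA3. axis_point \<in> L} = line_at_inf ` {v :: 'a. v \<noteq> 0 \<and> v \<notin> nonzero_squares}"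
proof (intro equalityI subsetI)
  fix L :: "('a ^ 4) set" assume L: "L \<in> {L \<in> EA3. axis_point \<in> L}"
  then have "L \<in> EA_lines" "axis_point \<in> L" by (auto simp: EA3_def)
  then show "L \<in> line_at_inf ` {v :: 'a. v \<noteq> 0 \<and> v \<notin> nonzero_squares}"
    by (cases rule: EA_line_through_axis_point_cases)
       (use L in \<open>auto simp: line_at_inf_in_EA3_iff line_through_notin_EA2_EA3\<close>)
qed (auto simp: line_at_inf_in_EA3_iff)

lemma card_EA1: "card (EA1 :: ('a ^ 4) set set) = (CARD('a) + 1) * (CARD('a) * (CARD('a) - 1))"
proof -
  have "card {L \<in> EA1. axis_point \<in> (L :: ('a ^ 4) set)} = card {(u, v :: 'a). u \<noteq> v ^ 3}"
    unfolding EA1_through_axis_point by (rule card_image) (auto simp: inj_on_def)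
  \<comment> \<open>For each v exactly one u is excluded; the swap puts v first, as the dependent
    product requires.\<close>
  also have "{(u, v :: 'a). u \<noteq> v ^ 3} = prod.swap ` (SIGMA v : UNIV. UNIV - {v ^ 3})"
    by auto
  also have "card \<dots> = card (SIGMA v : (UNIV :: 'a set). UNIV - {v ^ 3})"
    by (rule card_image) simp
  also have "\<dots> = CARD('a) * (CARD('a) - 1)" by (simp add: card_Diff_singleton)
  finally show ?thesis by (simp add: card_EA_class[OF invariant_EA1 EA_classes_subset(1)])
qed

lemma card_EA2: "2 * card (EA2 :: ('a ^ 4) set set) = (CARD('a) + 1) * (CARD('a) - 1)"
proof -
  have "card {L \<in> EA2. axis_point \<in> (L :: ('a ^ 4) set)} = card (nonzero_squares :: 'a set)"
    unfolding EA2_through_axis_point by (rule card_image) (auto simp: inj_on_def)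
  then show ?thesis
    unfolding card_EA_class[OF invariant_EA2 EA_classes_subset(2)] using card_nonzero_squares
    by (simp only: mult.left_commute[of 2])
qed

lemma card_EA3: "2 * card (EA3 :: ('a ^ 4) set set) = (CARD('a) + 1) * (CARD('a) - 1)"
proof -
  have "card {L \<in> EA3. axis_point \<in> (L :: ('a ^ 4) set)} = card {v :: 'a. v \<noteq> 0 \<and> v \<notin> nonzero_squares}"
    unfolding EA3_through_axis_point by (rule card_image) (auto simp: inj_on_def)
  then show ?thesis
    unfolding card_EA_class[OF invariant_EA3 EA_classes_subset(3)] using card_nonsquares
    by (simp only: mult.left_commute[of 2])
qed

section \<open>Computation of the incidence numbers\<close>

lemma Pi_numberI:
  fixes R :: "('a ^ 4) set"
  assumes move: "\<And>L. L \<in> K \<Longrightarrow> \<exists>A \<in> cubic_matrices. act A L = R"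
    and n: "of_nat (card {S \<in> plane_class d. R \<subseteq> S}) = n"
  shows "Pi_number (plane_class d) K n"
  unfolding Pi_number_def
proof
  fix L assume "L \<in> K"
  then obtain A where A: "A \<in> cubic_matrices" "act A L = R" using move by blast
  have "card {S \<in> plane_class d. L \<subseteq> S} = card {S \<in> plane_class d. R \<subseteq> S}"
  proof (rule card_invariant_class[OF invariant_plane_class A(1)])
    show "L \<subseteq> S \<longleftrightarrow> R \<subseteq> act A S" for S
      unfolding A(2)[symmetric] act_subset_iff[OF cubic_matricesD[OF A(1)]] ..
  qed
  then show "of_nat (card {S \<in> plane_class d. L \<subseteq> S}) = n" using n by simp
qed

text \<open>Every plane meets the axis, so a motion takes it to a plane through
  \<open>axis_point\<close>, which has the form
  \<open>plane_through \<alpha> \<beta>\<close>.\<close>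

lemma Lambda_numberI:
  fixes K :: "('a ^ 4) set set"
  assumes inv: "invariant_class K"
    and n: "\<And>\<alpha> \<beta>. plane_through \<alpha> \<beta> \<in> plane_class d \<Longrightarrow>
      of_nat (card {L \<in> K. L \<subseteq> plane_through \<alpha> \<beta>}) = n"
  shows "Lambda_number K (plane_class d) n"
  unfolding Lambda_number_def
proof
  fix S :: "('a ^ 4) set"
  assume S: "S \<in> plane_class d"
  then have plane: "S \<in> pg_planes" "vec.subspace S" by (simp_all add: plane_class_def pg_planes_def)
  obtain x where x: "x \<in> axis" "x \<noteq> 0" "x \<in> S" using pg_plane_meets_axis[OF plane(1)] .
  obtain A where A: "A \<in> cubic_matrices" "axis_point \<in> act A S"
    using move_subspace_to_axis_point[OF x plane(2)] .
  have AS: "act A S \<in> plane_class d" by (rule plane_class_act[OF A(1) S])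
  then obtain \<alpha> \<beta> where eq: "act A S = plane_through \<alpha> \<beta>"
    using plane_through_axis_point[of "act A S"] A(2) by (auto simp: plane_class_def)
  have "card {L \<in> K. L \<subseteq> S} = card {L \<in> K. L \<subseteq> plane_through \<alpha> \<beta>}"
  proof (rule card_invariant_class[OF inv A(1)])
    show "L \<subseteq> S \<longleftrightarrow> act A L \<subseteq> plane_through \<alpha> \<beta>" for L
      unfolding eq[symmetric] act_subset_iff[OF cubic_matricesD[OF A(1)]] ..
  qed
  then show "of_nat (card {L \<in> K. L \<subseteq> S}) = n" using n AS by (simp add: eq)
qed

text \<open>\<open>plane_through \<alpha> \<beta>\<close> meets the axis only in
  \<open>axis_point\<close>: x0 = x3 = 0 forces x2 = 0.\<close>

lemma axis_point_in_EA_line: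
  assumes "L \<in> EA_lines" "L \<subseteq> plane_through \<alpha> (\<beta> :: 'a)"
  shows "axis_point \<in> L"
proof -
  obtain x where x: "x \<in> axis" "x \<noteq> 0" "x \<in> L" "vec.subspace L"
    using assms(1) by (auto simp: line_in_EA_iff pg_lines_def)
  have "x \<in> plane_through \<alpha> \<beta>" using x(3) assms(2) by (rule subsetD[rotated])
  then have "axis_point = (1 / x $ 2) *s x"
    using x(1,2) by (auto simp: axis_eq plane_through_def vec4_eq_iff)
  then show ?thesis using x(3,4) vec.subspace_scale by metis
qed

lemma EA_class_in_plane:
  fixes \<alpha> \<beta> :: 'a
  assumes "K \<subseteq> EA_lines" "{L \<in> K. axis_point \<in> L} = X"
  shows "{L \<in> K. L \<subseteq> plane_through \<alpha> \<beta>} = {L \<in> X. L \<subseteq> plane_through \<alpha> \<beta>}"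
proof -
  have "axis_point \<in> L" if "L \<in> K" "L \<subseteq> plane_through \<alpha> \<beta>" for L
  proof -
    have "L \<in> EA_lines" using that(1) assms(1) by (rule subsetD[rotated])
    then show ?thesis using that(2) by (rule axis_point_in_EA_line)
  qed
  then show ?thesis unfolding assms(2)[symmetric] by blast
qed

text \<open>The lines are given by u with v = \<alpha> u + \<beta>. The excluded values u = v^3 are
  the cubes of the parameters of the cubic points in the plane.\<close>

lemma card_EA1_in_plane_through:
  fixes \<alpha> \<beta> :: 'a
  shows "card {L \<in> EA1. L \<subseteq> plane_through \<alpha> \<beta>} = CARD('a) - card (plane_params \<alpha> \<beta>)"
proof -
  have "{L \<in> EA1. L \<subseteq> plane_through \<alpha> \<beta>} =
    (\<lambda>u. line_through u (\<alpha> * u + \<beta>)) ` (UNIV - {u. u = (\<alpha> * u + \<beta>) ^ 3})"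
    unfolding EA_class_in_plane[OF EA_classes_subset(1) EA1_through_axis_point]
    by (rule set_eqI) (auto simp: line_through_subset_iff del: subsetI)
  also have "card \<dots> = card (UNIV - {u. u = (\<alpha> * u + \<beta>) ^ 3})"
    by (rule card_image) (auto simp: inj_on_def)
  also have "\<dots> = CARD('a) - card {u. u = (\<alpha> * u + \<beta>) ^ 3}"
    by (rule card_Diff_subset) simp_all
  also have "{u. u = (\<alpha> * u + \<beta>) ^ 3} = (\<lambda>t. t ^ 3) ` plane_params \<alpha> \<beta>"
  proof (intro equalityI subsetI)
    fix u assume "u \<in> {u. u = (\<alpha> * u + \<beta>) ^ 3}"
    then have u: "u = (\<alpha> * u + \<beta>) ^ 3" by blast
    have "\<alpha> * u + \<beta> = \<alpha> * (\<alpha> * u + \<beta>) ^ 3 + \<beta>" unfolding u[symmetric] ..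
    then have "\<alpha> * u + \<beta> \<in> plane_params \<alpha> \<beta>" unfolding plane_params_def by blast
    then show "u \<in> (\<lambda>t. t ^ 3) ` plane_params \<alpha> \<beta>" by (rule rev_image_eqI) (rule u)
  next
    fix u assume "u \<in> (\<lambda>t. t ^ 3) ` plane_params \<alpha> \<beta>"
    then obtain t where t: "u = t ^ 3" "t = \<alpha> * t ^ 3 + \<beta>" by (auto simp: plane_params_def)
    show "u \<in> {u. u = (\<alpha> * u + \<beta>) ^ 3}"
      unfolding mem_Collect_eq t(1) t(2)[symmetric] ..
  qed
  also have "card \<dots> = card (plane_params \<alpha> \<beta>)"
    by (rule card_image) (simp add: inj_on_def cube_eq_iff)
  finally show ?thesis .
qed

lemma card_EA2_in_plane_through:
  fixes \<alpha> \<beta> :: 'a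
  shows "card {L \<in> EA2. L \<subseteq> plane_through \<alpha> \<beta>} = (if \<alpha> \<in> nonzero_squares then 1 else 0)"
proof -
  have "{L \<in> EA2. L \<subseteq> plane_through \<alpha> \<beta>} = (if \<alpha> \<in> nonzero_squares then {line_at_inf \<alpha>} else {})"
    unfolding EA_class_in_plane[OF EA_classes_subset(2) EA2_through_axis_point]
    by (rule set_eqI) (auto simp: line_at_inf_subset_iff del: subsetI)
  then show ?thesis by simp
qed

lemma card_EA3_in_plane_through:
  fixes \<alpha> \<beta> :: 'a
  shows "card {L \<in> EA3. L \<subseteq> plane_through \<alpha> \<beta>} =
    (if \<alpha> \<noteq> 0 \<and> \<alpha> \<notin> nonzero_squares then 1 else 0)"
proof -
  have "{L \<in> EA3. L \<subseteq> plane_through \<alpha> \<beta>} =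
    (if \<alpha> \<noteq> 0 \<and> \<alpha> \<notin> nonzero_squares then {line_at_inf \<alpha>} else {})"
    unfolding EA_class_in_plane[OF EA_classes_subset(3) EA3_through_axis_point]
    by (rule set_eqI) (auto simp: line_at_inf_subset_iff del: subsetI)
  then show ?thesis by simp
qed

text \<open>The value is q minus the number of cubic points other than (1,0,0,0) in the plane; this
  number is 1, 1, 0 and 3 in the four cases.\<close>

lemma Lambda_EA1:
  "Lambda_number (EA1 :: ('a ^ 4) set set) (plane_class 2) (of_nat CARD('a) - 1)"
  "Lambda_number (EA1 :: ('a ^ 4) set set) (plane_class 1) (of_nat CARD('a) - 1)"
  "Lambda_number (EA1 :: ('a ^ 4) set set) (plane_class 0) (of_nat CARD('a))"
  "Lambda_number (EA1 :: ('a ^ 4) set set) (plane_class 3) (of_nat CARD('a) - 3)"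
proof -
  \<comment> \<open>As q is at least 9, the subtraction of natural numbers is not truncated.\<close>
  have *: "of_nat (CARD('a) - k) = (of_nat CARD('a) - of_nat k :: rat)" if "k \<le> 9" for k
    using that card_ge by (simp add: of_nat_diff)
  show "Lambda_number (EA1 :: ('a ^ 4) set set) (plane_class 2) (of_nat CARD('a) - 1)"
    by (rule Lambda_numberI[OF invariant_EA1])
      (simp only: plane_class_2_iff card_EA1_in_plane_through, simp add: plane_params_zero *)
  show "Lambda_number (EA1 :: ('a ^ 4) set set) (plane_class 1) (of_nat CARD('a) - 1)"
    by (rule Lambda_numberI[OF invariant_EA1])
      (simp only: plane_class_1_iff card_EA1_in_plane_through card_plane_params_nonsquare simp_thms, simp add: *)
  show "Lambda_number (EA1 :: ('a ^ 4) set set) (plane_class 0) (of_nat CARD('a))"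
    by (rule Lambda_numberI[OF invariant_EA1])
      (simp only: plane_class_0_iff card_EA1_in_plane_through, simp)
  show "Lambda_number (EA1 :: ('a ^ 4) set set) (plane_class 3) (of_nat CARD('a) - 3)"
    by (rule Lambda_numberI[OF invariant_EA1])
      (simp only: plane_class_3_iff card_EA1_in_plane_through card_plane_params_square simp_thms, simp add: *)
qed

lemma Lambda_EA2:
  "Lambda_number (EA2 :: ('a ^ 4) set set) (plane_class 3) 1"
  "Lambda_number (EA2 :: ('a ^ 4) set set) (plane_class 0) 1"
  "Lambda_number (EA2 :: ('a ^ 4) set set) (plane_class 2) 0"
  "Lambda_number (EA2 :: ('a ^ 4) set set) (plane_class 1) 0"
  by (rule Lambda_numberI[OF invariant_EA2],
      simp only: plane_class_0_iff plane_class_1_iff plane_class_2_iff plane_class_3_iff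
        card_EA2_in_plane_through, simp)+

lemma Lambda_EA3:
  "Lambda_number (EA3 :: ('a ^ 4) set set) (plane_class 1) 1"
  "Lambda_number (EA3 :: ('a ^ 4) set set) (plane_class 2) 0"
  "Lambda_number (EA3 :: ('a ^ 4) set set) (plane_class 3) 0"
  "Lambda_number (EA3 :: ('a ^ 4) set set) (plane_class 0) 0"
  by (rule Lambda_numberI[OF invariant_EA3],
      simp only: plane_class_0_iff plane_class_1_iff plane_class_2_iff plane_class_3_iff
        card_EA3_in_plane_through, simp)+

lemma Pi_EA1I:
  assumes "of_nat (card {\<alpha> :: 'a. plane_through \<alpha> (- \<alpha>) \<in> plane_class d}) = n"
  shows "Pi_number (plane_class d) (EA1 :: ('a ^ 4) set set) n"
  by (rule Pi_numberI[where R = "line_through 1 0"], erule EA1_move, erule bexI)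
    (simp_all add: card_planes_on_line_through assms)

lemma Pi_EA2I:
  assumes "of_nat (card {\<beta> :: 'a. plane_through 1 \<beta> \<in> plane_class d}) = n"
  shows "Pi_number (plane_class d) (EA2 :: ('a ^ 4) set set) n"
  by (rule Pi_numberI[where R = "line_at_inf 1"], erule EA2_move, erule bexI)
    (simp_all add: card_planes_on_line_at_inf assms)

lemma Pi_EA3I:
  fixes \<rho> :: 'a
  assumes \<rho>: "\<rho> \<noteq> 0" "\<rho> \<notin> nonzero_squares"
    and "of_nat (card {\<beta> :: 'a. plane_through \<rho> \<beta> \<in> plane_class d}) = n"
  shows "Pi_number (plane_class d) (EA3 :: ('a ^ 4) set set) n"
  by (rule Pi_numberI[where R = "line_at_inf \<rho>"], erule EA3_move[OF _ \<rho>], erule bexI)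
    (simp_all add: card_planes_on_line_at_inf assms)

text \<open>On \<open>line_through 1 0\<close> the planes with square \<alpha> split into
  \<open>?X\<close> with three cubic points and \<open>?Y\<close> with none. From 2 |X| + 1 = q / 3
  follows |X| = (q - 3) / 6, and |Y| = (q - 1) / 2 - |X| = q / 3.\<close>

lemma Pi_EA1:
  "Pi_number (plane_class 2) (EA1 :: ('a ^ 4) set set) 1"
  "Pi_number (plane_class 0) (EA1 :: ('a ^ 4) set set) (of_nat CARD('a) / 3)"
  "Pi_number (plane_class 3) (EA1 :: ('a ^ 4) set set) ((of_nat CARD('a) - 3) / 6)"
  "Pi_number (plane_class 1) (EA1 :: ('a ^ 4) set set) ((of_nat CARD('a) - 1) / 2)"
proof -
  let ?n = "card (artin_schreier_image :: 'a set)"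
  let ?X = "{\<alpha> :: 'a. \<alpha> \<in> nonzero_squares \<and> plane_params \<alpha> (- \<alpha>) \<noteq> {}}"
  let ?Y = "{\<alpha> :: 'a. \<alpha> \<in> nonzero_squares \<and> plane_params \<alpha> (- \<alpha>) = {}}"
  have n: "3 * ?n = CARD('a)" "?n \<ge> 1" using card_artin_schreier_image card_ge by linarith+
  \<comment> \<open>The bound \<open>?n \<ge> 1\<close> undoes the truncated subtraction in
    \<open>card_solvable_opposite\<close>.\<close>
  have X: "2 * card ?X + 1 = ?n" using card_solvable_opposite n by linarith
  have "card (?X \<union> ?Y) = card ?X + card ?Y" by (rule card_Un_disjoint) auto
  moreover have "?X \<union> ?Y = nonzero_squares" by blast
  ultimately have Y: "card ?Y = ?n"
    using card_nonzero_squares X n by simp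
  have nq: "(of_nat CARD('a) :: rat) = 3 * of_nat ?n" unfolding n(1)[symmetric] by simp
  have nX: "(of_nat ?n :: rat) = 2 * of_nat (card ?X) + 1" unfolding X[symmetric] by simp
  show "Pi_number (plane_class 2) (EA1 :: ('a ^ 4) set set) 1"
    by (rule Pi_EA1I) (simp add: plane_class_2_iff)
  show "Pi_number (plane_class 0) (EA1 :: ('a ^ 4) set set) (of_nat CARD('a) / 3)"
    by (rule Pi_EA1I, unfold plane_class_0_iff Y nq) simp
  show "Pi_number (plane_class 3) (EA1 :: ('a ^ 4) set set) ((of_nat CARD('a) - 3) / 6)"
    by (rule Pi_EA1I, unfold plane_class_3_iff nq nX) simp
  have N: "2 * card {x :: 'a. x \<noteq> 0 \<and> x \<notin> nonzero_squares} + 1 = CARD('a)"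
    using card_nonsquares card_ge by linarith
  show "Pi_number (plane_class 1) (EA1 :: ('a ^ 4) set set) ((of_nat CARD('a) - 1) / 2)"
    by (rule Pi_EA1I, unfold plane_class_1_iff N[symmetric]) simp
qed

text \<open>The planes on \<open>line_at_inf 1\<close> have \<alpha> = 1. They contain three cubic
  points if \<beta> lies in the Artin-Schreier image, a third of the field, and none
  otherwise.\<close>

lemma Pi_EA2:
  "Pi_number (plane_class 2) (EA2 :: ('a ^ 4) set set) 0"
  "Pi_number (plane_class 1) (EA2 :: ('a ^ 4) set set) 0"
  "Pi_number (plane_class 3) (EA2 :: ('a ^ 4) set set) (of_nat CARD('a) / 3)"
  "Pi_number (plane_class 0) (EA2 :: ('a ^ 4) set set) (2 * of_nat CARD('a) / 3)"
proof -
  let ?H = "artin_schreier_image :: 'a set"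
  have one: "(1 :: 'a) \<in> nonzero_squares"
    unfolding nonzero_squares_def by (rule image_eqI[of _ _ 1]) simp_all
  have q: "(of_nat CARD('a) :: rat) = 3 * of_nat (card ?H)"
    unfolding card_artin_schreier_image[symmetric] by simp
  have compl: "{\<beta> :: 'a. plane_params 1 \<beta> = {}} = UNIV - ?H"
    using plane_params_one by blast
  have "card (UNIV - ?H) = CARD('a) - card ?H" by (rule card_Diff_subset) simp_all
  then have c: "card (UNIV - ?H) = 2 * card ?H" using card_artin_schreier_image by simp
  show "Pi_number (plane_class 2) (EA2 :: ('a ^ 4) set set) 0"
    by (rule Pi_EA2I) (simp add: plane_class_2_iff)
  show "Pi_number (plane_class 1) (EA2 :: ('a ^ 4) set set) 0"
    by (rule Pi_EA2I) (simp only: plane_class_1_iff one, simp)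
  show "Pi_number (plane_class 3) (EA2 :: ('a ^ 4) set set) (of_nat CARD('a) / 3)"
    by (rule Pi_EA2I) (simp only: plane_class_3_iff one plane_params_one q, simp)
  show "Pi_number (plane_class 0) (EA2 :: ('a ^ 4) set set) (2 * of_nat CARD('a) / 3)"
    by (rule Pi_EA2I, unfold plane_class_0_iff) (simp add: one compl c q)
qed

text \<open>All q planes \<open>plane_through \<rho> \<beta>\<close> on the representative have a
  non-square \<alpha> = \<rho> and therefore exactly one cubic point.\<close>

lemma Pi_EA3:
  "Pi_number (plane_class 2) (EA3 :: ('a ^ 4) set set) 0"
  "Pi_number (plane_class 3) (EA3 :: ('a ^ 4) set set) 0"
  "Pi_number (plane_class 0) (EA3 :: ('a ^ 4) set set) 0"
  "Pi_number (plane_class 1) (EA3 :: ('a ^ 4) set set) (of_nat CARD('a))"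
proof -
  obtain \<rho> :: 'a where \<rho>: "\<rho> \<noteq> 0" "\<rho> \<notin> nonzero_squares" using ex_nonsquare by blast
  show "Pi_number (plane_class 2) (EA3 :: ('a ^ 4) set set) 0"
    by (rule Pi_EA3I[OF \<rho>]) (simp only: plane_class_2_iff \<rho>, simp)
  show "Pi_number (plane_class 3) (EA3 :: ('a ^ 4) set set) 0"
    by (rule Pi_EA3I[OF \<rho>]) (simp only: plane_class_3_iff \<rho>, simp)
  show "Pi_number (plane_class 0) (EA3 :: ('a ^ 4) set set) 0"
    by (rule Pi_EA3I[OF \<rho>]) (simp only: plane_class_0_iff \<rho>, simp)
  show "Pi_number (plane_class 1) (EA3 :: ('a ^ 4) set set) (of_nat CARD('a))"
    by (rule Pi_EA3I[OF \<rho>]) (simp only: plane_class_1_iff \<rho>, simp)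
qed

lemma card_EA_classes:
  "of_nat (card (EA1 :: ('a ^ 4) set set)) = (of_nat CARD('a) ^ 3 - of_nat CARD('a) :: rat)"
  "of_nat (card (EA2 :: ('a ^ 4) set set)) = ((of_nat CARD('a) ^ 2 - 1) / 2 :: rat)"
  "of_nat (card (EA3 :: ('a ^ 4) set set)) = ((of_nat CARD('a) ^ 2 - 1) / 2 :: rat)"
proof -
  have q: "of_nat (CARD('a) - 1) = (of_nat CARD('a) - 1 :: rat)"
    using card_ge by (simp add: of_nat_diff)
  show "of_nat (card (EA1 :: ('a ^ 4) set set)) = (of_nat CARD('a) ^ 3 - of_nat CARD('a) :: rat)"
    unfolding card_EA1 of_nat_mult of_nat_add q
    by (simp add: algebra_simps power3_eq_cube)
  have half: "of_nat m = ((of_nat CARD('a) ^ 2 - 1) / 2 :: rat)"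
    if "2 * m = (CARD('a) + 1) * (CARD('a) - 1)" for m
  proof -
    have "2 * of_nat m = (of_nat ((CARD('a) + 1) * (CARD('a) - 1)) :: rat)"
      unfolding that[symmetric] by simp
    then show ?thesis
      unfolding of_nat_mult of_nat_add q by (simp add: algebra_simps power2_eq_square)
  qed
  show "of_nat (card (EA2 :: ('a ^ 4) set set)) = ((of_nat CARD('a) ^ 2 - 1) / 2 :: rat)"
    "of_nat (card (EA3 :: ('a ^ 4) set set)) = ((of_nat CARD('a) ^ 2 - 1) / 2 :: rat)"
    by (rule half[OF card_EA2], rule half[OF card_EA3])
qed

end

text \<open>Translation by 1 permutes the ring, so the sum of all elements equals itself plus the
  number of elements.\<close>

lemma of_nat_CARD_eq_0: "of_nat CARD('a) = (0 :: 'a :: {ring_1, finite})"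
proof -
  have "(\<Sum>x\<in>UNIV. x) = (\<Sum>x\<in>UNIV. x + 1 :: 'a)"
    by (rule sum.reindex_bij_betw[symmetric]) (rule bij_plus_right)
  then show ?thesis by (simp add: sum.distrib)
qed

theorem theorem7p7:
  fixes q :: nat
  assumes "CARD('a::{field,finite}) = q"
    and "\<exists>h. q = 3 ^ h"
    and "q \<ge> 9"
  shows "\<exists>O1 O2 O3 :: ('a ^ 4) set set.
    (EA_orbits :: ('a ^ 4) set set set) = {O1, O2, O3} \<and> distinct [O1, O2, O3] \<and>
    of_nat (card O1) = (of_nat q ^ 3 - of_nat q :: rat) \<and>
    of_nat (card O2) = ((of_nat q ^ 2 - 1) / 2 :: rat) \<and>
    of_nat (card O3) = ((of_nat q ^ 2 - 1) / 2 :: rat) \<and>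

    Pi_number (dC_planes 2) O1 1 \<and>
    Lambda_number O2 (dC_planes 3) 1 \<and>
    Lambda_number O2 (dC_planes 0) 1 \<and>
    Lambda_number O3 one_bar_planes 1 \<and>

    Lambda_number O1 (dC_planes 2) (of_nat q - 1) \<and>
    Lambda_number O1 one_bar_planes (of_nat q - 1) \<and>

    (\<forall>\<P> \<in> {dC_planes 2, one_bar_planes}. Pi_number \<P> O2 0 \<and> Lambda_number O2 \<P> 0) \<and>
    (\<forall>\<P> \<in> {dC_planes 2, dC_planes 3, dC_planes 0}. Pi_number \<P> O3 0 \<and> Lambda_number O3 \<P> 0) \<and>

    Pi_number one_bar_planes O3 (of_nat q) \<and>
    Lambda_number O1 (dC_planes 0) (of_nat q) \<and>
    Pi_number (dC_planes 3) O2 (of_nat q / 3) \<and>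
    Pi_number (dC_planes 0) O1 (of_nat q / 3) \<and>
    Pi_number (dC_planes 0) O2 (2 * of_nat q / 3) \<and>

    Pi_number (dC_planes 3) O1 ((of_nat q - 3) / 6) \<and>
    Lambda_number O1 (dC_planes 3) (of_nat q - 3) \<and>
    Pi_number one_bar_planes O1 ((of_nat q - 1) / 2)"
proof -
  obtain h where h: "q = 3 ^ h" using assms(2) by blast
  have "(3 :: 'a) ^ h = 0"
    using of_nat_CARD_eq_0[where 'a = 'a] unfolding assms(1) h by simp
  \<comment> \<open>In a field a vanishing power of 3 forces 3 = 0.\<close>
  then interpret char_3_field "TYPE('a)"
    using assms by unfold_locales simp_all
  note q = assms(1)[symmetric]
  have eqs: "(dC_planes 0 :: ('a ^ 4) set set) = plane_class 0"
    "(dC_planes 2 :: ('a ^ 4) set set) = plane_class 2"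
    "(dC_planes 3 :: ('a ^ 4) set set) = plane_class 3"
    by (rule dC_planes_eq, simp)+
  show ?thesis
    unfolding eqs one_bar_planes_eq q
    by (intro exI[of _ EA1] exI[of _ EA2] exI[of _ EA3] conjI EA_orbits_eq EA_classes_distinct
        card_EA_classes Pi_EA1 Pi_EA2 Pi_EA3 Lambda_EA1 Lambda_EA2 Lambda_EA3)
      (simp_all only: ball_simps Pi_EA2 Pi_EA3 Lambda_EA2 Lambda_EA3 simp_thms)
qed

end
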